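(* Let $(T(t))_{t\ge 0}$ be a contraction semigroup on $(X,\|\cdot\|)$, bi-continuous with respect to $\tau$, and let $(A,D(A))$ be its $\tau$-generator. Consider the following assertions: (a) $(T(t))_{t\ge 0}$ is $\tau$-mean ergodic; (b) the Cesàro means $(C(r))_{r>0}$ converge in the $\tau$-weak operator topology as $r\to\infty$, i.e., $\langle C(r)x,\phi\rangle$ converges as $r\to\infty$ for every $\phi\in X'_\tau$ and $x\in X$; (c) for every $x\in X$ there exists an unbounded sequence $(r_n)_{n\in\mathbb{N}}\subset\mathbb{R}^+$ such that $(C(r_n)x)_{n\in\mathbb{N}}$ has a $\tau$-weak accumulation point in $X$; (d) for every $x\in X$ one has $\overline{\mathrm{co}\{T(t)x : t\ge0\}}^{\tau}\cap\mathrm{fix}\,(T(t))_{t\ge0}\neq\varnothing$; (e) the fixed space $\mathrm{fix}\,(T(t))_{t\ge0}=\ker A$ separates the dual fixed space $\mathrm{fix}\,(T(t)')_{t\ge0}=\ker A'$ in $X'_\tau$. Then (a)$\Rightarrow$(b)$\Rightarrow$(c) and (a)$\Rightarrow$(d)$\Rightarrow$(e). Further, if for every $\|\cdot\|$-bounded sequence $(x_n)_{n\in\mathbb{N}}$ which is $\tau$-weakly convergent to $x$ it holds that $$\sigma(X,X'_\tau)\text{-}\lim_{n\to\infty}T(t)x_n=T(t)x\qquad\text{for every }t\ge0,$$ then (c)$\Rightarrow$(d). Finally, if the semigroup is equicontinuous, i.e., for every $p\in P_\tau$ there exist $c_p\ge1$ and $q\in P_\tau$ such that $$p(T(t)x)\le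 c_p\,q(x)\qquad\text{for all }x\in X,\ t\ge0,$$ then (e)$\Rightarrow$(a).
   Context: Setting: $(X,\|\cdot\|)$ is a Banach space with norm dual $X'$, and $\tau$ is a locally convex topology on $X$ such that: (i) every $\|\cdot\|$-bounded $\tau$-Cauchy sequence converges in $(X,\tau)$; (ii) $\tau$ is coarser than the $\|\cdot\|$-topology; (iii) the topological dual $X'_\tau$ of $(X,\tau)$ is norming for $X$, i.e. $\|x\|=\sup\{|\langle x,\phi\rangle| : \phi\in X'_\tau,\ \|\phi\|_{X'}\le 1\}$ for all $x\in X$. $P_\tau$ is a family of seminorms defining $\tau$, chosen so that $p(x)\le\|x\|$ for all $x\in X$, $p\in P_\tau$. A family $(T(t))_{t\ge0}$ of bounded linear operators on $(X,\|\cdot\|)$ is a bi-continuous semigroup with respect to $\tau$ if: $T(0)=I$ and $T(t+s)=T(t)T(s)$ for all $t,s\ge0$; there are $M\ge1$, $\omega\in\mathbb{R}$ with $\|T(t)x\|\le Me^{\omega t}\|x\|$ for all $t\ge 0$, $x\in X$; for each $x\in X$ the map $[0,\infty[\,\ni t\mapsto T(t)x\in X$ is $\tau$-continuous; and for every $\|\cdot\|$-bounded sequence $(x_n)$ which $\tau$-converges to $x$, $\tau\text{-}\lim_{n\to\infty}T(t)x_n=T(t)x$ uniformly for $t$ in bounded intervals of $[0,\infty[$. It is a contraction semigroup if $\|T(t)\|\le1$ for all $t\ge0$. The $\tau$-generator $(A,D(A))$ is defined by: $D(A)$ is the set of $x\in X$ such that $\sup_{0<t<1}\left\|\frac{T(t)x-x}{t}\right\|<\infty$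 and $\tau\text{-}\lim_{t\to0^+}\frac{T(t)x-x}{t}$ exists in $X$; $Ax$ is this limit. The Cesàro means are $C(r)x=\frac1r\int_0^rT(s)x\,ds$, $r>0$, $x\in X$ ($\tau$-Riemann integral). The semigroup is $\tau$-mean ergodic if $C(r)x$ $\tau$-converges in $X$ as $r\to\infty$ for every $x\in X$. $\mathrm{fix}\,(T(t))_{t\ge0}=\{x\in X : T(t)x=x\ \forall t\ge0\}$. $T(t)'$ is the adjoint of $T(t)$ on $X'$, and $A'$ is the adjoint of $A$. In (e), within $X'_\tau$, $\mathrm{fix}\,(T(t)')_{t\ge0}$ consists of the $x'\in X'_\tau$ with $T(t)'x'=x'$ for all $t\ge0$, and $\ker A'$ consists of the $x'\in X'_\tau$ with $\langle Ax,x'\rangle=0$ for all $x\in D(A)$. That $\mathrm{fix}\,(T(t))_{t\ge0}$ separates this dual fixed space means: for any two distinct elements $x'\neq y'$ of it there is $x\in\mathrm{fix}\,(T(t))_{t\ge0}$ with $\langle x,x'\rangle\neq\langle x,y'\rangle$. The $\tau$-weak topology is $\sigma(X,X'_\tau)$; $\mathrm{co}$ is the convex hull and $\overline{\,\cdot\,}^{\tau}$ the $\tau$-closure.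
   Formalization: In (b) convergence includes a bounded limit operator on X (scalar convergence alone makes (b)⇒(c) false); in (c) the unbounded sequence means r_n→∞ and an accumulation point means the limit of a subsequence (otherwise (c)⇒(d) is false). *)

theory Defs
  imports "HOL-Analysis.Analysis"
begin

text \<open>
  The scalar field is a type of class real_normed_field and euclidean_space, which
  by Frobenius' theorem means the reals or the complex numbers; its action on the (real)
  Banach space is the parameter \<open>scl\<close>. For real scalars, \<open>scl\<close> is \<open>(*\<^sub>R)\<close>.
\<close>

definition banach_scaling ::
  "('k::{real_normed_field,euclidean_space} \<Rightarrow> 'a::banach \<Rightarrow> 'a) \<Rightarrow> bool" where
  "banach_scaling scl \<longleftrightarrow>
     vector_space scl \<and>
     (\<forall>r x. scl (of_real r) x = r *\<^sub>R x) \<and>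
     (\<forall>c x. norm (scl c x) = norm c * norm x)"

definition is_seminorm ::
  "('k::{real_normed_field,euclidean_space} \<Rightarrow> 'a::banach \<Rightarrow> 'a) \<Rightarrow> ('a \<Rightarrow> real) \<Rightarrow> bool" where
  "is_seminorm scl p \<longleftrightarrow>
     (\<forall>x y. p (x + y) \<le> p x + p y) \<and> (\<forall>c x. p (scl c x) = norm c * p x)"

text \<open>The family need not be directed, so basic neighbourhoods use finite subfamilies.\<close>

definition seminorm_topology :: "('a::ab_group_add \<Rightarrow> real) set \<Rightarrow> 'a topology" where
  "seminorm_topology Q = topology (\<lambda>U. \<forall>x\<in>U. \<exists>F e. finite F \<and> F \<subseteq> Q \<and> e > 0 \<and>
     {y. \<forall>q\<in>F. q (y - x) < e} \<subseteq> U)"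

lemma openin_seminorm_topology:
  "openin (seminorm_topology Q) U \<longleftrightarrow>
     (\<forall>x\<in>U. \<exists>F e. finite F \<and> F \<subseteq> Q \<and> e > 0 \<and> {y. \<forall>q\<in>F. q (y - x) < e} \<subseteq> U)"
proof -
  define B where "B = (\<lambda>x F e. {y::'a. \<forall>q\<in>F. q (y - x) < (e::real)})"
  define L where "L = (\<lambda>U. \<forall>x\<in>U. \<exists>F e. finite F \<and> F \<subseteq> Q \<and> e > 0 \<and> B x F e \<subseteq> U)"
  have int: "L (S \<inter> T)" if S: "L S" and T: "L T" for S T
    unfolding L_def
  proof (rule ballI)
    fix x assume x: "x \<in> S \<inter> T"
    obtain F e where F: "finite F" "F \<subseteq> Q" "e > 0" "B x F e \<subseteq> S"
      using S[unfolded L_def, THEN bspec, OF IntD1[OF x]] by (elim exE conjE)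
    obtain G d where G: "finite G" "G \<subseteq> Q" "d > 0" "B x G d \<subseteq> T"
      using T[unfolded L_def, THEN bspec, OF IntD2[OF x]] by (elim exE conjE)
    have "B x (F \<union> G) (min e d) \<subseteq> B x F e \<inter> B x G d"
      unfolding B_def by auto
    then have "B x (F \<union> G) (min e d) \<subseteq> S \<inter> T"
      using F(4) G(4) by blast
    moreover have "finite (F \<union> G)" and "F \<union> G \<subseteq> Q" and "min e d > 0"
      using F G by simp_all
    ultimately show "\<exists>F e. finite F \<and> F \<subseteq> Q \<and> e > 0 \<and> B x F e \<subseteq> S \<inter> T"
      by (rule_tac exI[of _ "F \<union> G"], rule_tac exI[of _ "min e d"], simp)
  qed
  have un: "L (\<Union>\<K>)" if "\<forall>K\<in>\<K>. L K" for \<K>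
    unfolding L_def
  proof (rule ballI)
    fix x assume "x \<in> \<Union>\<K>"
    then obtain K where K: "K \<in> \<K>" "x \<in> K" by blast
    then have "L K" using that by simp
    then obtain F e where F: "finite F" "F \<subseteq> Q" "e > 0" "B x F e \<subseteq> K"
      using \<open>L K\<close>[unfolded L_def, THEN bspec, OF K(2)] by (elim exE conjE)
    moreover have "B x F e \<subseteq> \<Union>\<K>"
      using F(4) Union_upper[OF K(1)] by (rule subset_trans)
    ultimately show "\<exists>F e. finite F \<and> F \<subseteq> Q \<and> e > 0 \<and> B x F e \<subseteq> \<Union>\<K>"
      by (rule_tac exI[of _ F], rule_tac exI[of _ e], simp)
  qed
  have "istopology L"
    unfolding istopology_def using int un by simp
  then have "openin (topology L) U \<longleftrightarrow> L U"
    by (simp only: topology_inverse')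
  moreover have "seminorm_topology Q = topology L"
    unfolding seminorm_topology_def L_def B_def ..
  ultimately have "openin (seminorm_topology Q) U \<longleftrightarrow> L U"
    by (simp only:)
  then show ?thesis
    unfolding L_def B_def .
qed

lemma topspace_seminorm_topology [simp]: "topspace (seminorm_topology Q) = UNIV"
proof -
  have "openin (seminorm_topology Q) UNIV"
    unfolding openin_seminorm_topology
    by (intro ballI exI[of _ "{}"] exI[of _ "1::real"]) simp
  then show ?thesis
    using openin_subset by blast
qed

definition topological_dual ::
  "('k::{real_normed_field,euclidean_space} \<Rightarrow> 'a::banach \<Rightarrow> 'a) \<Rightarrow> 'a topology \<Rightarrow> ('a \<Rightarrow> 'k) set" where
  "topological_dual scl tau =
     {\<phi>. Vector_Spaces.linear scl (*) \<phi> \<and> continuous_map tau euclidean \<phi>}"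

definition weak_topology ::
  "('k::{real_normed_field,euclidean_space} \<Rightarrow> 'a::banach \<Rightarrow> 'a) \<Rightarrow> 'a topology \<Rightarrow> 'a topology" where
  "weak_topology scl tau =
     seminorm_topology {\<lambda>x. norm (\<phi> x) | \<phi>. \<phi> \<in> topological_dual scl tau}"

definition Cauchy_in :: "'a::ab_group_add topology \<Rightarrow> (nat \<Rightarrow> 'a) \<Rightarrow> bool" where
  "Cauchy_in tau x \<longleftrightarrow>
     (\<forall>U. openin tau U \<and> 0 \<in> U \<longrightarrow> (\<exists>N. \<forall>m\<ge>N. \<forall>n\<ge>N. x m - x n \<in> U))"

definition bicontinuous_setting ::
  "('k::{real_normed_field,euclidean_space} \<Rightarrow> 'a::banach \<Rightarrow> 'a) \<Rightarrow> 'a topology \<Rightarrow>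
   ('a \<Rightarrow> real) set \<Rightarrow> bool" where
  "bicontinuous_setting scl tau P \<longleftrightarrow>
     banach_scaling scl \<and>
     (\<forall>p\<in>P. is_seminorm scl p \<and> (\<forall>x. p x \<le> norm x)) \<and>
     tau = seminorm_topology P \<and>
     (\<forall>x. bounded (range x) \<and> Cauchy_in tau x \<longrightarrow> (\<exists>l. limitin tau x l sequentially)) \<and>
     (\<forall>U. openin tau U \<longrightarrow> open U) \<and>
     (\<forall>x. norm x = (SUP \<phi>\<in>{\<phi> \<in> topological_dual scl tau. onorm \<phi> \<le> 1}. norm (\<phi> x)))"

definition bounded_operator ::
  "('k::{real_normed_field,euclidean_space} \<Rightarrow> 'a::banach \<Rightarrow> 'a) \<Rightarrow> ('a \<Rightarrow> 'a) \<Rightarrow> bool" where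
  "bounded_operator scl S \<longleftrightarrow>
     Vector_Spaces.linear scl scl S \<and> (\<exists>B. \<forall>x. norm (S x) \<le> B * norm x)"

text \<open>Semigroups are functions on all of the reals of which only the values at
  nonnegative times are ever used.\<close>

definition bicontinuous_semigroup ::
  "('k::{real_normed_field,euclidean_space} \<Rightarrow> 'a::banach \<Rightarrow> 'a) \<Rightarrow> 'a topology \<Rightarrow>
   (real \<Rightarrow> 'a \<Rightarrow> 'a) \<Rightarrow> bool" where
  "bicontinuous_semigroup scl tau T \<longleftrightarrow>
     (\<forall>t\<ge>0. bounded_operator scl (T t)) \<and>
     T 0 = id \<and> (\<forall>t\<ge>0. \<forall>s\<ge>0. T (t + s) = T t \<circ> T s) \<and>
     (\<exists>M\<ge>1. \<exists>\<omega>. \<forall>t\<ge>0. \<forall>x. norm (T t x) \<le> M * exp (\<omega> * t) * norm x) \<and>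
     (\<forall>x. continuous_map (top_of_set {0..}) tau (\<lambda>t. T t x)) \<and>
     (\<forall>x l. bounded (range x) \<and> limitin tau x l sequentially \<longrightarrow>
        (\<forall>b\<ge>0. \<forall>U. openin tau U \<and> 0 \<in> U \<longrightarrow>
           (\<forall>\<^sub>F n in sequentially. \<forall>t\<in>{0..b}. T t (x n) - T t l \<in> U)))"

definition contraction_semigroup :: "(real \<Rightarrow> 'a::banach \<Rightarrow> 'a) \<Rightarrow> bool" where
  "contraction_semigroup T \<longleftrightarrow> (\<forall>t\<ge>0. onorm (T t) \<le> 1)"

definition gen_domain :: "'a::banach topology \<Rightarrow> (real \<Rightarrow> 'a \<Rightarrow> 'a) \<Rightarrow> 'a set" where
  "gen_domain tau T =
     {x. bdd_above ((\<lambda>t. norm ((T t x - x) /\<^sub>R t)) ` {0<..<1}) \<and>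
         (\<exists>y. limitin tau (\<lambda>t. (T t x - x) /\<^sub>R t) y (at_right 0))}"

definition gen :: "'a::banach topology \<Rightarrow> (real \<Rightarrow> 'a \<Rightarrow> 'a) \<Rightarrow> 'a \<Rightarrow> 'a" where
  "gen tau T x = (THE y. limitin tau (\<lambda>t. (T t x - x) /\<^sub>R t) y (at_right 0))"

definition ker_gen :: "'a::banach topology \<Rightarrow> (real \<Rightarrow> 'a \<Rightarrow> 'a) \<Rightarrow> 'a set" where
  "ker_gen tau T = {x \<in> gen_domain tau T. gen tau T x = 0}"

definition has_Riemann_integral ::
  "'a::banach topology \<Rightarrow> (real \<Rightarrow> 'a) \<Rightarrow> 'a \<Rightarrow> real \<Rightarrow> real \<Rightarrow> bool" where
  "has_Riemann_integral tau f I a b \<longleftrightarrow>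
     (\<forall>U. openin tau U \<and> I \<in> U \<longrightarrow>
        (\<exists>d>0. \<forall>\<D>. \<D> tagged_division_of {a..b} \<and> (\<forall>(s, K)\<in>\<D>. measure lborel K < d) \<longrightarrow>
           (\<Sum>(s, K)\<in>\<D>. measure lborel K *\<^sub>R f s) \<in> U))"

definition cesaro :: "'a::banach topology \<Rightarrow> (real \<Rightarrow> 'a \<Rightarrow> 'a) \<Rightarrow> real \<Rightarrow> 'a \<Rightarrow> 'a" where
  "cesaro tau T r x = (1 / r) *\<^sub>R (THE I. has_Riemann_integral tau (\<lambda>s. T s x) I 0 r)"

definition fix_space :: "(real \<Rightarrow> 'a \<Rightarrow> 'a) \<Rightarrow> 'a set" where
  "fix_space T = {x. \<forall>t\<ge>0. T t x = x}"

text \<open>The adjoint of \<open>T t\<close> maps \<open>\<phi>\<close> to \<open>\<phi> \<circ> T t\<close>.\<close>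

definition dual_fix_space ::
  "('k::{real_normed_field,euclidean_space} \<Rightarrow> 'a::banach \<Rightarrow> 'a) \<Rightarrow> 'a topology \<Rightarrow>
   (real \<Rightarrow> 'a \<Rightarrow> 'a) \<Rightarrow> ('a \<Rightarrow> 'k) set" where
  "dual_fix_space scl tau T = {\<phi> \<in> topological_dual scl tau. \<forall>t\<ge>0. \<phi> \<circ> T t = \<phi>}"

definition ker_adjoint_gen ::
  "('k::{real_normed_field,euclidean_space} \<Rightarrow> 'a::banach \<Rightarrow> 'a) \<Rightarrow> 'a topology \<Rightarrow>
   (real \<Rightarrow> 'a \<Rightarrow> 'a) \<Rightarrow> ('a \<Rightarrow> 'k) set" where
  "ker_adjoint_gen scl tau T =
     {\<phi> \<in> topological_dual scl tau. \<forall>x\<in>gen_domain tau T. \<phi> (gen tau T x) = 0}"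

definition mean_ergodic :: "'a::banach topology \<Rightarrow> (real \<Rightarrow> 'a \<Rightarrow> 'a) \<Rightarrow> bool" where
  "mean_ergodic tau T \<longleftrightarrow> (\<forall>x. \<exists>y. limitin tau (\<lambda>r. cesaro tau T r x) y at_top)"

text \<open>Convergence in the weak operator topology includes the existence of a limit operator
  on the space itself; scalar convergence alone would only give a limit in the algebraic dual
  of the topological dual.\<close>

definition weakly_mean_ergodic ::
  "('k::{real_normed_field,euclidean_space} \<Rightarrow> 'a::banach \<Rightarrow> 'a) \<Rightarrow> 'a topology \<Rightarrow>
   (real \<Rightarrow> 'a \<Rightarrow> 'a) \<Rightarrow> bool" where
  "weakly_mean_ergodic scl tau T \<longleftrightarrow>
     (\<exists>E. bounded_operator scl E \<and>
        (\<forall>x. \<forall>\<phi>\<in>topological_dual scl tau.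
           ((\<lambda>r. \<phi> (cesaro tau T r x)) \<longlongrightarrow> \<phi> (E x)) at_top))"

text \<open>The times tend to infinity, and an accumulation point of a sequence is the limit of a
  subsequence; weaker readings (an unbounded sequence with bounded subsequences, topological
  cluster points) do not fit the sequential continuity condition below.\<close>

definition weak_accumulation ::
  "('k::{real_normed_field,euclidean_space} \<Rightarrow> 'a::banach \<Rightarrow> 'a) \<Rightarrow> 'a topology \<Rightarrow>
   (real \<Rightarrow> 'a \<Rightarrow> 'a) \<Rightarrow> bool" where
  "weak_accumulation scl tau T \<longleftrightarrow>
     (\<forall>x. \<exists>r. (\<forall>n. r n > 0) \<and> filterlim r at_top sequentially \<and>
        (\<exists>y k. strict_mono (k :: nat \<Rightarrow> nat) \<and>
           limitin (weak_topology scl tau) (\<lambda>n. cesaro tau T (r (k n)) x) y sequentially))"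

definition hull_meets_fix :: "'a::banach topology \<Rightarrow> (real \<Rightarrow> 'a \<Rightarrow> 'a) \<Rightarrow> bool" where
  "hull_meets_fix tau T \<longleftrightarrow>
     (\<forall>x. tau closure_of (convex hull ((\<lambda>t. T t x) ` {0..})) \<inter> fix_space T \<noteq> {})"

definition fix_separates ::
  "('k::{real_normed_field,euclidean_space} \<Rightarrow> 'a::banach \<Rightarrow> 'a) \<Rightarrow> 'a topology \<Rightarrow>
   (real \<Rightarrow> 'a \<Rightarrow> 'a) \<Rightarrow> bool" where
  "fix_separates scl tau T \<longleftrightarrow>
     (\<forall>\<phi>\<in>dual_fix_space scl tau T. \<forall>\<psi>\<in>dual_fix_space scl tau T.
        \<phi> \<noteq> \<psi> \<longrightarrow> (\<exists>x\<in>fix_space T. \<phi> x \<noteq> \<psi> x))"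

definition weakly_seq_continuous ::
  "('k::{real_normed_field,euclidean_space} \<Rightarrow> 'a::banach \<Rightarrow> 'a) \<Rightarrow> 'a topology \<Rightarrow>
   (real \<Rightarrow> 'a \<Rightarrow> 'a) \<Rightarrow> bool" where
  "weakly_seq_continuous scl tau T \<longleftrightarrow>
     (\<forall>x l. bounded (range x) \<and> limitin (weak_topology scl tau) x l sequentially \<longrightarrow>
        (\<forall>t\<ge>0. limitin (weak_topology scl tau) (\<lambda>n. T t (x n)) (T t l) sequentially))"

definition equicontinuous_semigroup ::
  "('a::banach \<Rightarrow> real) set \<Rightarrow> (real \<Rightarrow> 'a \<Rightarrow> 'a) \<Rightarrow> bool" where
  "equicontinuous_semigroup P T \<longleftrightarrow>
     (\<forall>p\<in>P. \<exists>c\<ge>1. \<exists>q\<in>P. \<forall>x. \<forall>t\<ge>0. p (T t x) \<le> c * q x)"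

end

theory Submission
  imports Defs
begin

text \<open>
  Everything is tested against scalar functionals: a continuous seminorm is attained at a
  functional it dominates (Hahn--Banach), so \<open>\<tau>\<close>-Riemann integrals and their estimates reduce to
  integrals of continuous scalar functions. With \<open>J r x = \<integral>\<^sub>0\<^sup>r T(s)x ds\<close> the basic identity is
  \<open>T(h) (J r x) - J r x = J h (T(r)x - x)\<close>. It shows that \<open>J r x\<close> is in the domain of the generator
  with image \<open>T(r)x - x\<close>, which gives both kernel identities, and that
  \<open>T(h) C(r)x - C(r)x \<rightarrow> 0\<close> in norm as \<open>r \<rightarrow> \<infinity>\<close>. So limits of the means are fixed points, and
  by separation weak limits lie in the closed convex hull of the orbit. For (e) \<open>\<Longrightarrow>\<close> (a), the vectors
  with convergent means form a \<open>\<tau>\<close>-closed subspace containing the fixed space and all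
  \<open>T(t)x - x\<close>; a functional vanishing on it is a fixed point of the adjoint semigroup that
  vanishes on the fixed space, hence is zero.
\<close>

section \<open>Sublinear functionals\<close>

text \<open>The operators \<open>T t\<close> are assumed continuous only along norm-bounded
  tau-convergent sequences, and completeness is assumed only for norm-bounded Cauchy sequences. So a
  limit is formed, or moved through \<open>T t\<close>, along a sequence that carries a norm bound:
  integrals are reached by sequences of tagged divisions, the kernel of the generator by a sequence
  of times, the limits of the means by integer times. The bounds come from contractivity and, for
  the generator, from the boundedness required in its domain. Hahn-Banach is used with a margin:
  \<open>linear_separation\<close> turns a lower bound \<open>e\<close> for the distance from a
  point to a convex set into a gap \<open>e\<close> between values of a functional. With the set {0}
  this gives functionals that attain a seminorm, with the hull of an orbit it detects the closure,
  and with a subspace it gives functionals vanishing there. Real and complex scalars are treated at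
  once: the inner product of the scalar field supplies both real parts, as \<open>inner c 1\<close>,
  and conjugates.\<close>

definition sublinear :: "('a::real_vector \<Rightarrow> real) \<Rightarrow> bool" where
  "sublinear p \<longleftrightarrow>
     (\<forall>x y. p (x + y) \<le> p x + p y) \<and> (\<forall>r\<ge>0. \<forall>x. p (r *\<^sub>R x) = r * p x)"

text \<open>The scaling inequality applied to \<open>inverse r\<close> and
  \<open>r *\<^sub>R x\<close> is its own converse.\<close>

lemma sublinearI:
  assumes add: "\<And>x y. p (x + y) \<le> p x + p y"
    and scale: "\<And>r x. r > 0 \<Longrightarrow> p (r *\<^sub>R x) \<le> r * p x"
    and zero: "p 0 = 0"
  shows "sublinear p"
proof -
  have "p (r *\<^sub>R x) = r * p x" if "r \<ge> 0" for r x
  proof (cases "r = 0")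
    case False
    then have r: "r > 0" using that by simp
    have "p (inverse r *\<^sub>R (r *\<^sub>R x)) \<le> inverse r * p (r *\<^sub>R x)"
      using r by (intro scale) simp
    then have "r * p x \<le> p (r *\<^sub>R x)"
      using r by (simp add: field_simps)
    then show ?thesis using scale[OF r, of x] by simp
  qed (use zero in simp)
  then show ?thesis using add by (simp add: sublinear_def)
qed

lemma sublinear_add: "sublinear p \<Longrightarrow> p (x + y) \<le> p x + p y"
  and sublinear_scale: "sublinear p \<Longrightarrow> r \<ge> 0 \<Longrightarrow> p (r *\<^sub>R x) = r * p x"
  and sublinear_0: "sublinear p \<Longrightarrow> p 0 = 0"
  and sublinear_lower: "sublinear p \<Longrightarrow> - p (- x) \<le> p x"
proof -
  assume p: "sublinear p"
  show "p (x + y) \<le> p x + p y" and "r \<ge> 0 \<Longrightarrow> p (r *\<^sub>R x) = r * p x"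
    using p by (auto simp: sublinear_def)
  have "p (0 *\<^sub>R 0) = 0 * p 0" using p unfolding sublinear_def by blast
  then show 0: "p 0 = 0" by simp
  have "p (x + - x) \<le> p x + p (- x)" using p unfolding sublinear_def by blast
  with 0 show "- p (- x) \<le> p x" by simp
qed

text \<open>The common pattern of three constructions: an infimum along a ray, over a chain of
  functionals, and over multiples of points of a convex set. The conditions at 0 force the value 0
  there.\<close>

lemma sublinear_INF:
  fixes g :: "'i \<Rightarrow> 'a::real_vector \<Rightarrow> real"
  assumes bdd: "\<And>x. bdd_below ((\<lambda>i. g i x) ` I)"
    and add: "\<And>i j x y. i \<in> I \<Longrightarrow> j \<in> I \<Longrightarrow> \<exists>k\<in>I. g k (x + y) \<le> g i x + g j y"
    and scale: "\<And>i r x. i \<in> I \<Longrightarrow> r > 0 \<Longrightarrow> \<exists>k\<in>I. g k (r *\<^sub>R x) \<le> r * g i x"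
    and nonneg: "\<And>i. i \<in> I \<Longrightarrow> 0 \<le> g i 0"
    and zero: "\<exists>i\<in>I. g i 0 \<le> 0"
  shows "sublinear (\<lambda>x. INF i\<in>I. g i x)"
proof (rule sublinearI)
  have ne: "I \<noteq> {}" using zero by blast
  have le: "(INF i\<in>I. g i x) \<le> g i x" if "i \<in> I" for i x
    using cINF_lower[OF bdd that] .
  have greatest: "m \<le> (INF i\<in>I. g i x)" if "\<And>i. i \<in> I \<Longrightarrow> m \<le> g i x" for m x
    using cINF_greatest[OF ne that] .
  show "(INF i\<in>I. g i (x + y)) \<le> (INF i\<in>I. g i x) + (INF i\<in>I. g i y)" for x y
  proof -
    have "(INF i\<in>I. g i (x + y)) - g j y \<le> (INF i\<in>I. g i x)" if j: "j \<in> I" for j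
    proof (rule greatest)
      fix i assume "i \<in> I"
      then obtain k where "k \<in> I" "g k (x + y) \<le> g i x + g j y" using add j by blast
      then show "(INF i\<in>I. g i (x + y)) - g j y \<le> g i x" using le[of k "x + y"] by linarith
    qed
    then have "(INF i\<in>I. g i (x + y)) - (INF i\<in>I. g i x) \<le> (INF i\<in>I. g i y)"
      by (intro greatest) (simp add: algebra_simps)
    then show ?thesis by simp
  qed
  show "(INF i\<in>I. g i (r *\<^sub>R x)) \<le> r * (INF i\<in>I. g i x)" if r: "r > 0" for r x
  proof -
    have "(INF i\<in>I. g i (r *\<^sub>R x)) / r \<le> (INF i\<in>I. g i x)"
    proof (rule greatest)
      fix i assume "i \<in> I"
      then obtain k where "k \<in> I" "g k (r *\<^sub>R x) \<le> r * g i x" using scale r by blast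
      then have "(INF i\<in>I. g i (r *\<^sub>R x)) \<le> r * g i x" using le[of k "r *\<^sub>R x"] by linarith
      then show "(INF i\<in>I. g i (r *\<^sub>R x)) / r \<le> g i x" using r by (simp add: field_simps)
    qed
    then show ?thesis using r by (simp add: field_simps)
  qed
  show "(INF i\<in>I. g i 0) = 0"
  proof (rule antisym)
    obtain i where "i \<in> I" "g i 0 \<le> 0" using zero by blast
    then show "(INF i\<in>I. g i 0) \<le> 0" using le[of i 0] by linarith
  qed (use nonneg in \<open>intro greatest\<close>)
qed

text \<open>For fixed \<open>y\<close>, the infimum over t \<ge> 0 of
  \<open>q (x + t *\<^sub>R y) - t * q y\<close> is again sublinear and, by t = 0, lies below
  \<open>q\<close>. By minimality it equals \<open>q\<close>, and t = 1 then gives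
  superadditivity.\<close>

lemma minimal_sublinear_linear:
  fixes q :: "'a::real_vector \<Rightarrow> real"
  assumes q: "sublinear q"
    and minimal: "\<And>q'. sublinear q' \<Longrightarrow> (\<And>x. q' x \<le> q x) \<Longrightarrow> q' = q"
  shows "linear q"
proof -
  have super: "q x + q y \<le> q (x + y)" for x y
  proof -
    define g where "g = (\<lambda>t x. q (x + t *\<^sub>R y) - t * q y)"
    have lower: "- q (- x) \<le> g t x" if "t \<ge> 0" for t x
      using sublinear_add[OF q, of "x + t *\<^sub>R y" "- x"] sublinear_scale[OF q that, of y]
      by (simp add: g_def)
    have bdd: "bdd_below ((\<lambda>t. g t x) ` {0..})" for x
      using lower by (intro bdd_belowI2[of _ "- q (- x)"]) simp
    have "sublinear (\<lambda>x. INF t\<in>{0..}. g t x)"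
    proof (rule sublinear_INF[OF bdd])
      show "\<exists>k\<in>{0..}. g k (x + z) \<le> g s x + g t z" if "s \<in> {0..}" "t \<in> {0..}" for s t x z
        using that sublinear_add[OF q, of "x + s *\<^sub>R y" "z + t *\<^sub>R y"]
        by (intro bexI[of _ "s + t"]) (simp_all add: g_def algebra_simps)
      show "\<exists>k\<in>{0..}. g k (r *\<^sub>R x) \<le> r * g t x" if "t \<in> {0..}" "r > 0" for t r x
        using that sublinear_scale[OF q, of r "x + t *\<^sub>R y"]
        by (intro bexI[of _ "r * t"]) (simp_all add: g_def algebra_simps)
      show "0 \<le> g t 0" if "t \<in> {0..}" for t
        using lower[of t 0] that sublinear_0[OF q] by simp
      show "\<exists>t\<in>{0..}. g t 0 \<le> 0"
        using sublinear_0[OF q] by (intro bexI[of _ 0]) (simp_all add: g_def)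
    qed
    moreover have "(INF t\<in>{0..}. g t x) \<le> q x" for x
      using cINF_lower[OF bdd, of 0 x] by (simp add: g_def)
    ultimately have "(\<lambda>x. INF t\<in>{0..}. g t x) = q" by (rule minimal)
    then have "q x = (INF t\<in>{0..}. g t x)" by metis
    then have "q x \<le> g 1 x" using cINF_lower[OF bdd, of 1 x] by simp
    then show ?thesis by (simp add: g_def)
  qed
  have add: "q (x + y) = q x + q y" for x y
    using super sublinear_add[OF q] by (intro antisym)
  have minus: "q (- x) = - q x" for x
    using add[of x "- x"] sublinear_0[OF q] by simp
  show ?thesis
  proof (rule linearI)
    show "q (r *\<^sub>R x) = r *\<^sub>R q x" for r x
      using sublinear_scale[OF q, of r x] sublinear_scale[OF q, of "- r" x] minus[of "r *\<^sub>R x"]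
      by (cases "r \<ge> 0") simp_all
  qed (rule add)
qed

text \<open>Zorn's lemma for the reversed pointwise order yields a minimal sublinear functional
  below \<open>p\<close>, which is linear. The infimum of a chain stays finite because all its
  members lie above \<open>- p (- x)\<close>.\<close>

lemma sublinear_dominates_linear:
  fixes p :: "'a::real_vector \<Rightarrow> real"
  assumes p: "sublinear p"
  shows "\<exists>u. linear u \<and> (\<forall>x. u x \<le> p x)"
proof -
  define A where "A = {q. sublinear q \<and> (\<forall>x. q x \<le> p x)}"
  have "\<exists>m\<in>A. \<forall>a\<in>A. a \<le> m \<longrightarrow> a = m"
  proof (rule predicate_Zorn)
    show "partial_order_on A (relation_of (\<lambda>f g. g \<le> f) A)"
      by (intro partial_order_on_relation_ofI) auto
    fix C assume C: "C \<in> Chains (relation_of (\<lambda>f g. g \<le> f) A)"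
    then have CA: "q \<in> A" if "q \<in> C" for q
      using that by (auto simp: Chains_def relation_of_def)
    have chain: "q \<le> r \<or> r \<le> q" if "q \<in> C" "r \<in> C" for q r
      using C that by (auto simp: Chains_def relation_of_def)
    show "\<exists>u\<in>A. \<forall>a\<in>C. u \<le> a"
    proof (cases "C = {}")
      case True
      then show ?thesis using p by (auto simp: A_def)
    next
      case False
      then obtain q0 where q0: "q0 \<in> C" by blast
      have lower: "- p (- x) \<le> q x" if "q \<in> C" for q x
      proof -
        have "sublinear q" "q (- x) \<le> p (- x)" using CA[OF that] by (auto simp: A_def)
        then show ?thesis using sublinear_lower[of q x] by linarith
      qed
      have bdd: "bdd_below ((\<lambda>q. q x) ` C)" for x
        using lower by (intro bdd_belowI2[of _ "- p (- x)"]) simp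
      have sub: "sublinear q" if "q \<in> C" for q
        using CA[OF that] by (simp add: A_def)
      have "sublinear (\<lambda>x. INF q\<in>C. q x)"
      proof (rule sublinear_INF[OF bdd])
        show "\<exists>k\<in>C. k (x + y) \<le> q x + r y" if "q \<in> C" "r \<in> C" for q r x y
          using chain[OF that]
        proof
          assume "q \<le> r"
          then have "q (x + y) \<le> q x + r y"
            using sublinear_add[OF sub[OF that(1)], of x y] le_funD[of q r y] by linarith
          then show ?thesis using that by blast
        next
          assume "r \<le> q"
          then have "r (x + y) \<le> q x + r y"
            using sublinear_add[OF sub[OF that(2)], of x y] le_funD[of r q x] by linarith
          then show ?thesis using that by blast
        qed
        show "\<exists>k\<in>C. k (r *\<^sub>R x) \<le> r * q x" if "q \<in> C" "r > 0" for q r x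
          using that sublinear_scale[OF sub[OF that(1)], of r x] by (intro bexI[of _ q]) simp_all
        show "0 \<le> q 0" if "q \<in> C" for q
          using sublinear_0[OF sub[OF that]] by simp
        show "\<exists>q\<in>C. q 0 \<le> 0"
          using q0 sublinear_0[OF sub[OF q0]] by (intro bexI[of _ q0]) simp_all
      qed
      moreover have "(INF q\<in>C. q x) \<le> q x" if "q \<in> C" for q x
        using cINF_lower[OF bdd that] .
      moreover have "(INF q\<in>C. q x) \<le> p x" for x
        using cINF_lower[OF bdd q0, of x] CA[OF q0] by (auto simp: A_def intro: order_trans)
      ultimately show ?thesis
        by (intro bexI[of _ "\<lambda>x. INF q\<in>C. q x"]) (auto simp: A_def le_fun_def)
    qed
  qed
  then obtain m where m: "m \<in> A" "\<And>a. a \<in> A \<Longrightarrow> a \<le> m \<Longrightarrow> a = m" by blast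
  have "linear m"
  proof (rule minimal_sublinear_linear)
    show "sublinear m" using m(1) by (simp add: A_def)
    fix q' assume q': "sublinear q'" "\<And>x. q' x \<le> m x"
    have "q' \<in> A" using q' m(1) by (auto simp: A_def intro: order_trans)
    then show "q' = m" using m(2) q'(2) by (simp add: le_fun_def)
  qed
  then show ?thesis using m(1) by (auto simp: A_def)
qed

text \<open>Both required inequalities are encoded in one sublinear functional, the infimum of
  \<open>g\<close>. A linear functional below it is below \<open>q\<close> by t = 0, and t = 1 at
  the point \<open>c - x0\<close> gives the gap \<open>e\<close>. The infimum is finite since
  \<open>t * e \<le> q (t *\<^sub>R (x0 - c))\<close>.\<close>

lemma linear_separation:
  fixes q :: "'a::real_vector \<Rightarrow> real"
  assumes q: "sublinear q"
    and minus: "\<And>x. q (- x) = q x"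
    and C: "convex C" "C \<noteq> {}"
    and e: "0 \<le> e" "\<And>c. c \<in> C \<Longrightarrow> e \<le> q (x0 - c)"
  shows "\<exists>u. linear u \<and> (\<forall>x. u x \<le> q x) \<and> (\<forall>c\<in>C. u c + e \<le> u x0)"
proof -
  define g where "g = (\<lambda>(t, c) x. q (x + t *\<^sub>R (x0 - c)) - t * e)"
  define I where "I = {0::real..} \<times> C"
  obtain c0 where c0: "c0 \<in> C" using C by blast
  have lower: "- q x \<le> g i x" if i: "i \<in> I" for i x
  proof -
    obtain t c where tc: "i = (t, c)" "t \<ge> 0" "c \<in> C" using i by (auto simp: I_def)
    have "t * e \<le> q (t *\<^sub>R (x0 - c))"
      using tc e by (simp add: sublinear_scale[OF q] mult_left_mono)
    then show ?thesis
      using sublinear_add[OF q, of "x + t *\<^sub>R (x0 - c)" "- x"] minus[of x] by (simp add: g_def tc)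
  qed
  have bdd: "bdd_below ((\<lambda>i. g i x) ` I)" for x
    using lower by (intro bdd_belowI2[of _ "- q x"])
  have "sublinear (\<lambda>x. INF i\<in>I. g i x)"
  proof (rule sublinear_INF[OF bdd])
    fix i j x y assume "i \<in> I" "j \<in> I"
    then obtain s c t d where i: "i = (s, c)" "s \<ge> 0" "c \<in> C" and j: "j = (t, d)" "t \<ge> 0" "d \<in> C"
      by (auto simp: I_def)
    \<comment> \<open>Convexity merges two multiples of points of \<open>C\<close> into a multiple
      of one point. If s + t = 0, both multiples vanish and any point of \<open>C\<close> will
      do.\<close>
    have "\<exists>b\<in>C. (s + t) *\<^sub>R b = s *\<^sub>R c + t *\<^sub>R d"
    proof (cases "s + t = 0")
      case True
      then show ?thesis using i j c0 by (auto simp: add_nonneg_eq_0_iff)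
    next
      case False
      then have "(s / (s + t)) *\<^sub>R c + (t / (s + t)) *\<^sub>R d \<in> C"
        using i j by (intro convexD[OF C(1)]) (simp_all add: add_divide_distrib[symmetric])
      then show ?thesis
        using False by (intro bexI[of _ "(s / (s + t)) *\<^sub>R c + (t / (s + t)) *\<^sub>R d"])
          (simp_all add: scaleR_add_right)
    qed
    then obtain b where b: "b \<in> C" "(s + t) *\<^sub>R b = s *\<^sub>R c + t *\<^sub>R d" by blast
    have "x + y + (s + t) *\<^sub>R (x0 - b) = (x + s *\<^sub>R (x0 - c)) + (y + t *\<^sub>R (x0 - d))"
      unfolding scaleR_diff_right b(2) by (simp add: algebra_simps)
    then have "q (x + y + (s + t) *\<^sub>R (x0 - b)) \<le> q (x + s *\<^sub>R (x0 - c)) + q (y + t *\<^sub>R (x0 - d))"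
      using sublinear_add[OF q] by metis
    then show "\<exists>k\<in>I. g k (x + y) \<le> g i x + g j y"
      using i j b by (intro bexI[of _ "(s + t, b)"]) (simp_all add: g_def I_def algebra_simps)
  next
    fix i r x assume "i \<in> I" "(r::real) > 0"
    then obtain t c where i: "i = (t, c)" "t \<ge> 0" "c \<in> C" by (auto simp: I_def)
    have "r *\<^sub>R x + (r * t) *\<^sub>R (x0 - c) = r *\<^sub>R (x + t *\<^sub>R (x0 - c))"
      by (simp add: algebra_simps)
    then have "g (r * t, c) (r *\<^sub>R x) = r * g (t, c) x"
      using sublinear_scale[OF q, of r "x + t *\<^sub>R (x0 - c)"] \<open>r > 0\<close>
      by (simp add: g_def right_diff_distrib)
    then show "\<exists>k\<in>I. g k (r *\<^sub>R x) \<le> r * g i x"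
      using i \<open>r > 0\<close> by (intro bexI[of _ "(r * t, c)"]) (simp_all add: I_def)
  next
    show "0 \<le> g i 0" if "i \<in> I" for i
      using lower[OF that, of 0] sublinear_0[OF q] by simp
    show "\<exists>i\<in>I. g i 0 \<le> 0"
      using c0 sublinear_0[OF q] by (intro bexI[of _ "(0, c0)"]) (simp_all add: g_def I_def)
  qed
  then obtain u where u: "linear u" "\<And>x. u x \<le> (INF i\<in>I. g i x)"
    using sublinear_dominates_linear by blast
  have le: "u x \<le> g i x" if "i \<in> I" for i x
    using u(2)[of x] cINF_lower[OF bdd that, of x] by linarith
  have "u x \<le> q x" for x
    using le[of "(0, c0)" x] c0 by (simp add: g_def I_def)
  moreover have "u c + e \<le> u x0" if "c \<in> C" for c
  proof -
    have "u (c - x0) \<le> - e"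
      using le[of "(1, c)" "c - x0"] that sublinear_0[OF q] by (simp add: g_def I_def)
    then show ?thesis using linear_diff[OF u(1), of c x0] by simp
  qed
  ultimately show ?thesis using u(1) by blast
qed

section \<open>Extension of scalars\<close>

text \<open>The conjugate in a form that makes sense for both scalar fields; at 0 it is 0, since
  \<open>inverse 0 = 0\<close>.\<close>

definition field_conj :: "'k::{real_normed_field,euclidean_space} \<Rightarrow> 'k" where
  "field_conj d = (norm d)\<^sup>2 *\<^sub>R inverse d"

text \<open>Multiplication by \<open>d\<close> multiplies norms by \<open>norm d\<close>, so by
  polarization it multiplies inner products by the square. Hence its adjoint is multiplication by
  the conjugate.\<close>

lemma inner_mult_right:
  fixes c d e :: "'k::{real_normed_field,euclidean_space}"
  shows "inner (c * d) e = inner c (field_conj d * e)"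
proof (cases "d = 0")
  case False
  have sim: "inner (c * d) (b * d) = (norm d)\<^sup>2 * inner c b" for b
  proof -
    have "norm (c * d + b * d) = norm (c + b) * norm d"
      by (simp add: norm_mult flip: distrib_right)
    then show ?thesis
      by (simp add: dot_norm norm_mult power_mult_distrib algebra_simps)
  qed
  have "inner (c * d) e = (norm d)\<^sup>2 * inner c (inverse d * e)"
    using sim[of "e * inverse d"] False by (simp add: mult.assoc mult.commute[of "inverse d" e])
  then show ?thesis by (simp add: field_conj_def)
qed (simp add: field_conj_def)

lemma inner_field_conj:
  fixes c d :: "'k::{real_normed_field,euclidean_space}"
  shows "inner c (field_conj d) = inner (c * d) 1"
  by (simp add: inner_mult_right)

text \<open>Additivity is hidden by the quotient formula, but an adjoint depends additively on its
  operator.\<close>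

lemma field_conj_add: "field_conj (c + d) = field_conj c + field_conj d"
proof -
  have "inner x (field_conj (c + d)) = inner x (field_conj c + field_conj d)" for x
    by (simp add: inner_field_conj inner_add_right inner_add_left distrib_left)
  then show ?thesis using vector_eq_ldot by blast
qed

lemma field_conj_mult: "field_conj (c * d) = field_conj c * field_conj d"
  by (simp add: field_conj_def norm_mult power_mult_distrib)

lemma norm_field_conj [simp]: "norm (field_conj d) = norm d"
  by (cases "d = 0") (simp_all add: field_conj_def norm_inverse power2_eq_square)

lemma field_conj_field_conj [simp]: "field_conj (field_conj d) = d"
proof (cases "d = 0")
  case False
  have "field_conj (field_conj d) = (norm (field_conj d))\<^sup>2 *\<^sub>R inverse (field_conj d)"
    by (subst field_conj_def) simp
  then show ?thesis
    using False by (simp only: norm_field_conj) (simp add: field_conj_def nonzero_inverse_scaleR_distrib)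
qed (simp add: field_conj_def)

lemma banach_scaling_mult: "banach_scaling scl \<Longrightarrow> scl c (scl d x) = scl (c * d) x"
  and banach_scaling_add_left: "banach_scaling scl \<Longrightarrow> scl (c + d) x = scl c x + scl d x"
  and banach_scaling_add_right: "banach_scaling scl \<Longrightarrow> scl c (x + y) = scl c x + scl c y"
  and banach_scaling_of_real: "banach_scaling scl \<Longrightarrow> scl (of_real r) x = r *\<^sub>R x"
  by (simp_all add: banach_scaling_def vector_space_def)

lemma banach_scaling_scaleR:
  assumes "banach_scaling scl"
  shows "scl (r *\<^sub>R c) x = r *\<^sub>R scl c x" "scl c (r *\<^sub>R x) = r *\<^sub>R scl c x"
  using banach_scaling_mult[OF assms] banach_scaling_of_real[OF assms]
  by (metis scaleR_conv_of_real, metis mult.commute)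

text \<open>For complex scalars this is the familiar \<open>\<phi> x = u x - \<i> u (\<i> x)\<close>: for fixed \<open>x\<close>,
  the conjugate of \<open>\<phi> x\<close> represents the real functional \<open>c \<mapsto> u (c x)\<close>.\<close>

lemma scalar_extension:
  fixes scl :: "'k::{real_normed_field,euclidean_space} \<Rightarrow> 'a::banach \<Rightarrow> 'a"
  assumes scl: "banach_scaling scl"
    and u: "linear u" "\<And>x. u x \<le> q x"
    and q: "\<And>c x. q (scl c x) = norm c * q x" "\<And>x. 0 \<le> q x"
  shows "\<exists>\<phi>. Vector_Spaces.linear scl (*) \<phi> \<and> (\<forall>x. norm (\<phi> x) \<le> q x) \<and> (\<forall>x. inner (\<phi> x) 1 = u x)"
proof -
  \<comment> \<open>\<open>adjoint\<close> supplies the Riesz representative of the real functional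
    \<open>\<lambda>c. u (scl c x)\<close> on the scalar field.\<close>
  define \<psi> where "\<psi> x = adjoint (\<lambda>c. u (scl c x)) 1" for x
  have \<psi>: "inner c (\<psi> x) = u (scl c x)" for c x
  proof -
    have "linear (\<lambda>c. u (scl c x))"
      by (rule linearI) (simp_all add: banach_scaling_add_left[OF scl] banach_scaling_scaleR[OF scl]
          linear_add[OF u(1)] linear_scale[OF u(1)])
    then show ?thesis unfolding \<psi>_def by (simp add: adjoint_works)
  qed
  define \<phi> where "\<phi> x = field_conj (\<psi> x)" for x
  have add: "\<psi> (x + y) = \<psi> x + \<psi> y" for x y
  proof -
    have "inner c (\<psi> (x + y)) = inner c (\<psi> x + \<psi> y)" for c
      by (simp add: \<psi> inner_add_right banach_scaling_add_right[OF scl] linear_add[OF u(1)])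
    then show ?thesis using vector_eq_ldot by blast
  qed
  have scale: "\<psi> (scl d x) = field_conj d * \<psi> x" for d x
  proof -
    have "inner c (\<psi> (scl d x)) = inner c (field_conj d * \<psi> x)" for c
      by (simp add: \<psi> banach_scaling_mult[OF scl] inner_mult_right[symmetric])
    then show ?thesis using vector_eq_ldot by blast
  qed
  have "Vector_Spaces.linear scl (*) \<phi>"
    unfolding Vector_Spaces.linear_iff
    using scl by (auto simp: \<phi>_def add scale field_conj_add field_conj_mult banach_scaling_def
        vector_space_def algebra_simps)
  moreover have "norm (\<phi> x) \<le> q x" for x
  proof (cases "\<psi> x = 0")
    case False
    \<comment> \<open>The representation is evaluated at the representative itself, so that the
      bound for \<open>u\<close> costs exactly one factor of its norm.\<close>
    have "norm (\<psi> x) * norm (\<psi> x) = u (scl (\<psi> x) x)"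
      by (simp add: \<psi>[symmetric] dot_square_norm power2_eq_square)
    also have "\<dots> \<le> norm (\<psi> x) * q x" using u(2) q(1) by metis
    finally show ?thesis using False by (simp add: \<phi>_def)
  qed (simp add: \<phi>_def q(2))
  moreover have "inner (\<phi> x) 1 = u x" for x
    using \<psi>[of 1 x] inner_field_conj[of 1 "\<phi> x"] banach_scaling_of_real[OF scl, of 1 x]
    by (simp add: \<phi>_def)
  ultimately show ?thesis by blast
qed

section \<open>Seminorm topologies and the dual space\<close>

lemma is_seminormD:
  assumes scl: "banach_scaling scl" and p: "is_seminorm scl p"
  shows is_seminorm_add: "p (x + y) \<le> p x + p y"
    and is_seminorm_scale: "p (scl c x) = norm c * p x"
    and is_seminorm_scaleR: "p (r *\<^sub>R x) = \<bar>r\<bar> * p x"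
    and is_seminorm_0: "p 0 = 0"
    and is_seminorm_minus: "p (- x) = p x"
    and is_seminorm_nonneg: "0 \<le> p x"
proof -
  show add: "p (x + y) \<le> p x + p y" for x y
    using p by (simp add: is_seminorm_def)
  show "p (scl c x) = norm c * p x"
    using p by (simp add: is_seminorm_def)
  show scaleR: "p (r *\<^sub>R x) = \<bar>r\<bar> * p x" for r x
    using p banach_scaling_of_real[OF scl, of r x] unfolding is_seminorm_def by (metis norm_of_real)
  show zero: "p 0 = 0" using scaleR[of 0 0] by simp
  show minus: "p (- x) = p x" for x using scaleR[of "-1" x] by simp
  show "0 \<le> p x" using add[of x "- x"] zero minus[of x] by simp
qed

lemma openin_seminorm_topology_ball:
  assumes "q \<in> Q" "\<And>x y. q (x + y) \<le> q x + q y"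
  shows "openin (seminorm_topology Q) {y. q (y - x) < e}"
  unfolding openin_seminorm_topology
proof (intro ballI exI conjI)
  fix z assume z: "z \<in> {y. q (y - x) < e}"
  show "finite {q}" "{q} \<subseteq> Q" "e - q (z - x) > 0" using assms z by simp_all
  show "{y. \<forall>r\<in>{q}. r (y - z) < e - q (z - x)} \<subseteq> {y. q (y - x) < e}"
  proof clarsimp
    fix y assume "q (y - z) < e - q (z - x)"
    then show "q (y - x) < e" using assms(2)[of "y - z" "z - x"] by simp
  qed
qed

text \<open>Serves two families: \<open>P\<close> itself, and the absolute values of functionals,
  which define the weak topology.\<close>

lemma limitin_seminorm_topology:
  assumes "\<And>q x y. q \<in> Q \<Longrightarrow> q (x + y) \<le> q x + q y"
    and "\<And>q. q \<in> Q \<Longrightarrow> q 0 = 0" "\<And>q x. q \<in> Q \<Longrightarrow> 0 \<le> q x"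
  shows "limitin (seminorm_topology Q) f l F \<longleftrightarrow> (\<forall>q\<in>Q. ((\<lambda>i. q (f i - l)) \<longlongrightarrow> 0) F)"
proof safe
  fix q assume lim: "limitin (seminorm_topology Q) f l F" and q: "q \<in> Q"
  show "((\<lambda>i. q (f i - l)) \<longlongrightarrow> 0) F"
  proof (rule tendstoI)
    fix e :: real assume "e > 0"
    then have "\<forall>\<^sub>F i in F. f i \<in> {y. q (y - l) < e}"
      using q assms(1) assms(2)[OF q]
      by (intro limitinD[OF lim openin_seminorm_topology_ball]) simp_all
    then show "\<forall>\<^sub>F i in F. dist (q (f i - l)) 0 < e"
      using assms(3)[OF q] by (simp add: dist_real_def)
  qed
next
  assume lim: "\<forall>q\<in>Q. ((\<lambda>i. q (f i - l)) \<longlongrightarrow> 0) F"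
  show "limitin (seminorm_topology Q) f l F"
    unfolding limitin_def
  proof (intro conjI allI impI)
    fix U assume "openin (seminorm_topology Q) U \<and> l \<in> U"
    then obtain G e where G: "finite G" "G \<subseteq> Q" "e > 0" "{y. \<forall>q\<in>G. q (y - l) < e} \<subseteq> U"
      unfolding openin_seminorm_topology by meson
    have "\<forall>q\<in>G. \<forall>\<^sub>F i in F. q (f i - l) < e"
      using lim G by (auto intro: order_tendstoD)
    then have "\<forall>\<^sub>F i in F. \<forall>q\<in>G. q (f i - l) < e"
      using G(1) by (simp add: eventually_ball_finite)
    then show "\<forall>\<^sub>F i in F. f i \<in> U"
      by eventually_elim (use G(4) in blast)
  qed simp
qed

locale bicontinuous_space =
  fixes scl :: "'k::{real_normed_field,euclidean_space} \<Rightarrow> 'a::banach \<Rightarrow> 'a"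
    and tau :: "'a topology"
    and P :: "('a \<Rightarrow> real) set"
  assumes setting: "bicontinuous_setting scl tau P"
begin

abbreviation dual :: "('a \<Rightarrow> 'k) set" where
  "dual \<equiv> topological_dual scl tau"

lemma scl: "banach_scaling scl"
  and tau_eq: "tau = seminorm_topology P"
  and seminorm: "p \<in> P \<Longrightarrow> is_seminorm scl p"
  and seminorm_le_norm: "p \<in> P \<Longrightarrow> p x \<le> norm x"
  and bounded_Cauchy_limit: "bounded (range y) \<Longrightarrow> Cauchy_in tau y \<Longrightarrow> \<exists>l. limitin tau y l sequentially"
  and open_tau: "openin tau U \<Longrightarrow> open U"
  and norming: "norm x = (SUP \<phi>\<in>{\<phi> \<in> dual. onorm \<phi> \<le> 1}. norm (\<phi> x))"
  using setting by (auto simp: bicontinuous_setting_def)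

lemma topspace_tau [simp]: "topspace tau = UNIV"
  by (simp add: tau_eq)

lemmas p_add = is_seminorm_add[OF scl seminorm]
  and p_scale = is_seminorm_scale[OF scl seminorm]
  and p_scaleR = is_seminorm_scaleR[OF scl seminorm]
  and p_0 = is_seminorm_0[OF scl seminorm]
  and p_minus = is_seminorm_minus[OF scl seminorm]
  and p_nonneg = is_seminorm_nonneg[OF scl seminorm]

lemma p_minus_commute: "p \<in> P \<Longrightarrow> p (x - y) = p (y - x)"
  using p_minus[of p "x - y"] by simp

lemma limitin_tau_iff: "limitin tau f l F \<longleftrightarrow> (\<forall>p\<in>P. ((\<lambda>i. p (f i - l)) \<longlongrightarrow> 0) F)"
  unfolding tau_eq by (rule limitin_seminorm_topology) (auto intro: p_add p_0 p_nonneg)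

lemma dual_linear: "\<phi> \<in> dual \<Longrightarrow> linear \<phi>"
proof (rule linearI)
  assume \<phi>: "\<phi> \<in> dual"
  show "\<phi> (x + y) = \<phi> x + \<phi> y" for x y
    using \<phi> by (simp add: topological_dual_def Vector_Spaces.linear_iff)
  have "\<phi> (scl (of_real r) x) = of_real r * \<phi> x" for r x
    using \<phi> by (simp add: topological_dual_def Vector_Spaces.linear_iff)
  then show "\<phi> (r *\<^sub>R x) = r *\<^sub>R \<phi> x" for r x
    by (simp add: banach_scaling_of_real[OF scl] scaleR_conv_of_real)
qed

lemma dual_scl: "\<phi> \<in> dual \<Longrightarrow> \<phi> (scl c x) = c * \<phi> x"
  by (simp add: topological_dual_def Vector_Spaces.linear_iff)

lemmas dual_add = linear_add[OF dual_linear]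
  and dual_diff = linear_diff[OF dual_linear]
  and dual_scaleR = linear_scale[OF dual_linear]
  and dual_0 = linear_0[OF dual_linear]

lemma dual_continuous: "\<phi> \<in> dual \<Longrightarrow> continuous_map tau euclidean \<phi>"
  by (simp add: topological_dual_def)

lemma dual_tendsto:
  assumes "\<phi> \<in> dual" "limitin tau f l F"
  shows "((\<lambda>i. \<phi> (f i)) \<longlongrightarrow> \<phi> l) F"
  using continuous_map_limit[OF dual_continuous[OF assms(1)] assms(2)] by (simp add: o_def)

lemma openin_dual_ball: "\<phi> \<in> dual \<Longrightarrow> openin tau {y. norm (\<phi> (y - x)) < e}"
proof -
  assume \<phi>: "\<phi> \<in> dual"
  have "openin tau {y \<in> topspace tau. \<phi> y \<in> ball (\<phi> x) e}"
    by (rule openin_continuous_map_preimage[OF dual_continuous[OF \<phi>]]) simp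
  then show ?thesis
    by (simp add: dual_diff[OF \<phi>] dist_norm norm_minus_commute)
qed

text \<open>A tau-neighbourhood of 0 on which \<open>\<phi>\<close> is smaller than 1 is also open
  for the norm, so it contains a ball. This gives \<open>onorm\<close> its meaning on the
  dual.\<close>

lemma dual_bounded_linear: "\<phi> \<in> dual \<Longrightarrow> bounded_linear \<phi>"
proof -
  assume \<phi>: "\<phi> \<in> dual"
  have "open {y. norm (\<phi> (y - 0)) < 1}"
    by (rule open_tau[OF openin_dual_ball[OF \<phi>]])
  then obtain d where d: "d > 0" "ball 0 d \<subseteq> {y. norm (\<phi> y) < 1}"
    using dual_0[OF \<phi>] unfolding open_contains_ball
    by (metis (mono_tags, lifting) diff_zero mem_Collect_eq norm_zero zero_less_one
        Collect_cong)
  have "norm (\<phi> x) \<le> norm x * (2 / d)" for x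
  proof (cases "x = 0")
    case False
    define c where "c = d / (2 * norm x)"
    have c: "c > 0" using d False by (simp add: c_def)
    have "c *\<^sub>R x \<in> ball 0 d" using d False by (simp add: c_def)
    then have "norm (\<phi> (c *\<^sub>R x)) < 1" using d by blast
    then have "c * norm (\<phi> x) < 1" using c by (simp add: dual_scaleR[OF \<phi>])
    then show ?thesis using c d False by (simp add: c_def field_simps)
  qed (simp add: dual_0[OF \<phi>])
  then show ?thesis
    using dual_linear[OF \<phi>] by (intro bounded_linear_intro[where K = "2 / d"])
      (simp_all add: linear_add linear_scale)
qed

lemma norm_dual_le: "\<phi> \<in> dual \<Longrightarrow> onorm \<phi> \<le> 1 \<Longrightarrow> norm (\<phi> x) \<le> norm x"
  using onorm[OF dual_bounded_linear, of \<phi> x] mult_right_mono[of "onorm \<phi>" 1 "norm x"] by simp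

lemma zero_in_dual: "(\<lambda>x. 0) \<in> dual"
  using scl by (auto simp: topological_dual_def Vector_Spaces.linear_iff banach_scaling_def
      vector_space_def algebra_simps)

text \<open>This is how the norming hypothesis enters every norm estimate. The zero functional
  guarantees that the supremum is taken over a nonempty set.\<close>

lemma norm_le_if_dual:
  assumes "\<And>\<phi>. \<phi> \<in> dual \<Longrightarrow> onorm \<phi> \<le> 1 \<Longrightarrow> norm (\<phi> x) \<le> K"
  shows "norm x \<le> K"
proof -
  have "(\<lambda>x. 0) \<in> {\<phi> \<in> dual. onorm \<phi> \<le> 1}"
    using zero_in_dual by (simp add: onorm_zero)
  then show ?thesis
    unfolding norming[of x] by (intro cSUP_least) (use assms in auto)
qed

lemma dual_separates: "(\<And>\<phi>. \<phi> \<in> dual \<Longrightarrow> \<phi> x = \<phi> y) \<Longrightarrow> x = y"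
  using norm_le_if_dual[of "x - y" 0] by (simp add: dual_diff)

lemma dualI:
  assumes lin: "Vector_Spaces.linear scl (*) \<phi>"
    and F: "finite F" "F \<subseteq> P" and le: "\<And>x. norm (\<phi> x) \<le> (\<Sum>p\<in>F. p x)"
  shows "\<phi> \<in> dual"
proof -
  have "openin tau {x. \<phi> x \<in> V}" if "open V" for V
    unfolding tau_eq openin_seminorm_topology
  proof
    fix x assume "x \<in> {x. \<phi> x \<in> V}"
    then obtain e where e: "e > 0" "ball (\<phi> x) e \<subseteq> V"
      using \<open>open V\<close> unfolding open_contains_ball by blast
    \<comment> \<open>A sum of \<open>card F\<close> terms, each at most \<open>d\<close>, stays
      below \<open>e\<close>, also for empty \<open>F\<close>.\<close>
    define d where "d = e / (real (card F) + 1)"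
    have d: "d > 0" using e by (simp add: d_def)
    have "\<phi> y \<in> V" if "\<forall>p\<in>F. p (y - x) < d" for y
    proof -
      have "\<phi> (x + (y - x)) = \<phi> x + \<phi> (y - x)"
        using lin unfolding Vector_Spaces.linear_iff by blast
      then have "dist (\<phi> x) (\<phi> y) = norm (\<phi> (y - x))"
        by (simp add: dist_norm norm_minus_commute)
      also have "\<dots> \<le> (\<Sum>p\<in>F. p (y - x))" by (rule le)
      also have "\<dots> \<le> card F * d"
        using that by (intro sum_bounded_above) (auto intro: less_imp_le)
      also have "\<dots> < e" using e by (simp add: d_def field_simps)
      finally show ?thesis using e by auto
    qed
    then show "\<exists>F e. finite F \<and> F \<subseteq> P \<and> 0 < e \<and> {y. \<forall>q\<in>F. q (y - x) < e} \<subseteq> {x. \<phi> x \<in> V}"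
      using F d by (intro exI[of _ F] exI[of _ d]) auto
  qed
  then show ?thesis using lin by (simp add: topological_dual_def continuous_map_def)
qed

text \<open>The real separating functional is dominated by a finite sum of seminorms. Extension of
  scalars preserves this bound, and the bound gives tau-continuity. Finite sums are required because
  \<open>P\<close> need not be directed.\<close>

lemma dual_separation:
  assumes C: "convex C" "C \<noteq> {}" and F: "finite F" "F \<subseteq> P"
    and e: "0 \<le> e" "\<And>c. c \<in> C \<Longrightarrow> e \<le> (\<Sum>p\<in>F. p (x - c))"
  shows "\<exists>\<phi>\<in>dual. (\<forall>z. norm (\<phi> z) \<le> (\<Sum>p\<in>F. p z)) \<and> (\<forall>c\<in>C. inner (\<phi> c) 1 + e \<le> inner (\<phi> x) 1)"
proof -
  define q where "q z = (\<Sum>p\<in>F. p z)" for z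
  have "sublinear q"
    unfolding sublinear_def
  proof (intro conjI allI impI)
    show "q (y + z) \<le> q y + q z" for y z
      unfolding q_def sum.distrib[symmetric] using F by (intro sum_mono p_add) auto
    show "q (r *\<^sub>R z) = r * q z" if "r \<ge> 0" for r z
      unfolding q_def sum_distrib_left using F that by (intro sum.cong) (auto simp: p_scaleR)
  qed
  moreover have "q (- z) = q z" for z
    unfolding q_def using F by (intro sum.cong) (auto simp: p_minus)
  moreover have "e \<le> q (x - c)" if "c \<in> C" for c
    using e(2)[OF that] by (simp add: q_def)
  ultimately obtain u where u: "linear u" "\<And>z. u z \<le> q z" "\<And>c. c \<in> C \<Longrightarrow> u c + e \<le> u x"
    using linear_separation[of q C e x] C e(1) by blast
  have "q (scl c z) = norm c * q z" for c z
    unfolding q_def sum_distrib_left using F by (intro sum.cong) (auto simp: p_scale)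
  moreover have "0 \<le> q z" for z
    unfolding q_def using F by (intro sum_nonneg p_nonneg) auto
  ultimately obtain \<phi> where \<phi>: "Vector_Spaces.linear scl (*) \<phi>" "\<And>z. norm (\<phi> z) \<le> q z"
    "\<And>z. inner (\<phi> z) 1 = u z"
    using scalar_extension[OF scl u(1), of q] u(2) by blast
  have "\<phi> \<in> dual" using dualI[OF \<phi>(1) F] \<phi>(2) by (simp add: q_def)
  then show ?thesis
    using \<phi> u(3) unfolding q_def by (intro bexI[of _ \<phi>]) simp_all
qed

text \<open>Separation of \<open>x\<close> from {0} with margin \<open>p x\<close>.\<close>

lemma seminorm_attained:
  assumes p: "p \<in> P"
  obtains \<phi> where "\<phi> \<in> dual" "\<And>z. norm (\<phi> z) \<le> p z" "p x \<le> norm (\<phi> x)"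
proof -
  obtain \<phi> where \<phi>: "\<phi> \<in> dual" "\<And>z. norm (\<phi> z) \<le> p z" "inner (\<phi> 0) 1 + p x \<le> inner (\<phi> x) 1"
    using dual_separation[of "{0}" "{p}" "p x" x] p p_nonneg[OF p, of x] by auto
  have "p x \<le> inner (\<phi> x) 1" using \<phi> by (simp add: dual_0)
  also have "\<dots> \<le> norm (\<phi> x)" using norm_cauchy_schwarz[of "\<phi> x" 1] by simp
  finally show ?thesis using that \<phi> by blast
qed

lemma seminorm_le_if_dual:
  assumes "p \<in> P" "\<And>\<phi>. \<phi> \<in> dual \<Longrightarrow> (\<And>z. norm (\<phi> z) \<le> p z) \<Longrightarrow> norm (\<phi> x) \<le> K"
  shows "p x \<le> K"
  using seminorm_attained[OF assms(1), of x] assms(2) by (metis order_trans)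

end

section \<open>The Riemann integral\<close>

definition Riemann_sum :: "(real \<Rightarrow> 'b::real_vector) \<Rightarrow> (real \<times> real set) set \<Rightarrow> 'b" where
  "Riemann_sum f \<D> = (\<Sum>(s, K)\<in>\<D>. measure lborel K *\<^sub>R f s)"

text \<open>Named so that one sequence of divisions can be fixed and used for several
  integrands.\<close>

definition mesh_less :: "real \<Rightarrow> real \<Rightarrow> real \<Rightarrow> (real \<times> real set) set \<Rightarrow> bool" where
  "mesh_less a b d \<D> \<longleftrightarrow>
     \<D> tagged_division_of {a..b} \<and> (\<forall>(s, K)\<in>\<D>. measure lborel K < d)"

lemma has_Riemann_integral_iff:
  "has_Riemann_integral tau f I a b \<longleftrightarrow>
     (\<forall>U. openin tau U \<and> I \<in> U \<longrightarrow> (\<exists>d>0. \<forall>\<D>. mesh_less a b d \<D> \<longrightarrow> Riemann_sum f \<D> \<in> U))"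
  by (simp add: has_Riemann_integral_def Riemann_sum_def mesh_less_def)

lemma mesh_less_mono: "mesh_less a b d \<D> \<Longrightarrow> d \<le> d' \<Longrightarrow> mesh_less a b d' \<D>"
  by (auto simp: mesh_less_def)

lemma mesh_less_exists:
  assumes d: "d > 0"
  shows "\<exists>\<D>. mesh_less a b d \<D>"
proof -
  \<comment> \<open>Both endpoints of an interval lie within d/3 of its tag, so its length is below
    d.\<close>
  have "gauge (\<lambda>x::real. ball x (d / 3))" using d by (intro gauge_ball) simp
  then obtain \<D> where \<D>: "\<D> tagged_division_of {a..b}" "(\<lambda>x. ball x (d / 3)) fine \<D>"
    using fine_division_exists_real by blast
  have "measure lborel K < d" if sK: "(s, K) \<in> \<D>" for s K
  proof -
    obtain u v where K: "K = cbox u v" using tagged_division_ofD(4)[OF \<D>(1) sK] by metis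
    have "s \<in> K" using tagged_division_ofD(2)[OF \<D>(1) that] .
    then have uv: "u \<le> v" using K by simp
    have "K \<subseteq> ball s (d / 3)" using \<D>(2) that by (auto simp: fine_def)
    then have "u \<in> ball s (d / 3)" "v \<in> ball s (d / 3)" using K uv by auto
    then have "v - u < d" using d unfolding mem_ball dist_real_def by linarith
    then show ?thesis using K uv by simp
  qed
  then show ?thesis using \<D>(1) by (auto simp: mesh_less_def)
qed

lemma norm_Riemann_sum_le:
  assumes D: "mesh_less a b d \<D>" and ab: "a \<le> b" and B: "\<And>s. s \<in> {a..b} \<Longrightarrow> norm (f s) \<le> B"
  shows "norm (Riemann_sum f \<D>) \<le> B * (b - a)"
  using rsum_bound[of \<D> a b f B] D ab B by (simp add: Riemann_sum_def mesh_less_def)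

text \<open>On each interval of the division, \<open>g s - g t\<close> integrates to at most
  \<open>e\<close> times the length. The modulus is an explicit hypothesis so that one pair
  \<open>d\<close>, \<open>e\<close> can serve a whole family of functions.\<close>

lemma Riemann_sum_error:
  fixes g :: "real \<Rightarrow> 'b::banach"
  assumes cont: "continuous_on {a..b} g" and ab: "a \<le> b"
    and modulus: "\<And>s t. s \<in> {a..b} \<Longrightarrow> t \<in> {a..b} \<Longrightarrow> \<bar>s - t\<bar> < d \<Longrightarrow> norm (g s - g t) \<le> e"
    and e: "0 \<le> e" and D: "mesh_less a b d \<D>"
  shows "norm (Riemann_sum g \<D> - integral {a..b} g) \<le> e * (b - a)"
proof -
  have tag: "\<D> tagged_division_of cbox a b" using D by (simp add: mesh_less_def)
  have int: "g integrable_on cbox a b"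
    using integrable_continuous_real[OF cont] by simp
  have "integral {a..b} g = (\<Sum>(s, K)\<in>\<D>. integral K g)"
    using integral_combine_tagged_division_topdown[OF int tag] by simp
  then have "norm (Riemann_sum g \<D> - integral {a..b} g)
      = norm (\<Sum>(s, K)\<in>\<D>. measure lborel K *\<^sub>R g s - integral K g)"
    by (simp add: Riemann_sum_def sum_subtractf split_def)
  also have "\<dots> \<le> (\<Sum>(s, K)\<in>\<D>. e * measure lborel K)"
  proof (rule sum_norm_le, safe)
    fix s K assume sK: "(s, K) \<in> \<D>"
    obtain u v where K: "K = cbox u v" using tagged_division_ofD(4)[OF tag sK] by blast
    have s: "s \<in> K" using tagged_division_ofD(2)[OF tag sK] .
    have sub: "K \<subseteq> {a..b}" using tagged_division_ofD(3)[OF tag sK] by simp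
    have uv: "u \<le> v" using K s by simp
    have "measure lborel K < d" using D sK by (auto simp: mesh_less_def)
    then have "v - u < d" using K uv by simp
    have "g integrable_on cbox u v" using integrable_on_subcbox[OF int] sub K by simp
    then have "((\<lambda>t. g s - g t) has_integral (measure lborel K *\<^sub>R g s - integral K g)) (cbox u v)"
      unfolding K by (intro has_integral_diff has_integral_const integrable_integral)
    moreover have "norm (g s - g t) \<le> e" if "t \<in> cbox u v" for t
    proof -
      have "\<bar>s - t\<bar> < d" using that s K \<open>v - u < d\<close> by auto
      then show ?thesis using that s K sub by (intro modulus) auto
    qed
    ultimately show "norm (measure lborel K *\<^sub>R g s - integral K g) \<le> e * measure lborel K"
      unfolding K using e by (rule has_integral_bound[rotated])
  qed
  also have "\<dots> = e * (\<Sum>(s, K)\<in>\<D>. measure lborel K)"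
    by (simp add: sum_distrib_left split_def)
  also have "\<dots> = e * (b - a)"
    using additive_content_tagged_division[OF tag] ab by simp
  finally show ?thesis .
qed

lemma Riemann_sums_tendsto_integral:
  fixes g :: "real \<Rightarrow> 'b::banach"
  assumes cont: "continuous_on {a..b} g" and ab: "a \<le> b"
    and D: "\<And>n. mesh_less a b (inverse (real (Suc n))) (D n)"
  shows "(\<lambda>n. Riemann_sum g (D n)) \<longlonglongrightarrow> integral {a..b} g"
proof (rule tendstoI)
  fix \<epsilon> :: real assume "\<epsilon> > 0"
  \<comment> \<open>The summand 1 admits the degenerate interval a = b.\<close>
  define e where "e = \<epsilon> / 2 / (b - a + 1)"
  have pos: "b - a + 1 > 0" using ab by simp
  then have "e * (b - a + 1) = \<epsilon> / 2"
    unfolding e_def by (metis less_irrefl nonzero_eq_divide_eq)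
  with pos have "e > 0" "e * (b - a + 1) < \<epsilon>"
    using \<open>\<epsilon> > 0\<close> by (simp_all add: e_def)
  then have e: "e > 0" "e * (b - a) < \<epsilon>" by (simp_all add: distrib_left)
  have "uniformly_continuous_on {a..b} g"
    by (rule compact_uniformly_continuous[OF cont]) simp
  then obtain d where d: "d > 0"
    "\<And>s t. s \<in> {a..b} \<Longrightarrow> t \<in> {a..b} \<Longrightarrow> \<bar>s - t\<bar> < d \<Longrightarrow> norm (g s - g t) < e"
    unfolding uniformly_continuous_on_def dist_norm using e(1)
    by (metis real_norm_def abs_minus_commute norm_minus_commute)
  have "\<forall>\<^sub>F n in sequentially. inverse (real (Suc n)) < d"
    using LIMSEQ_inverse_real_of_nat d(1) by (rule order_tendstoD)
  then show "\<forall>\<^sub>F n in sequentially. dist (Riemann_sum g (D n)) (integral {a..b} g) < \<epsilon>"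
  proof eventually_elim
    case (elim n)
    have "norm (Riemann_sum g (D n) - integral {a..b} g) \<le> e * (b - a)"
    proof (rule Riemann_sum_error[OF cont ab])
      show "norm (g s - g t) \<le> e" if "s \<in> {a..b}" "t \<in> {a..b}" "\<bar>s - t\<bar> < d" for s t
        using d(2)[OF that] by simp
      show "mesh_less a b d (D n)" using mesh_less_mono[OF D[of n]] elim by simp
    qed (use e in simp)
    then show ?case using e(2) by (simp add: dist_norm)
  qed
qed

text \<open>Replaces the limit over all fine divisions by a sequential one, the only kind that can
  be moved through the semigroup.\<close>

lemma has_Riemann_integral_limitin:
  assumes I: "has_Riemann_integral tau f I a b" and top: "topspace tau = UNIV"
    and D: "\<And>n. mesh_less a b (inverse (real (Suc n))) (D n)"
  shows "limitin tau (\<lambda>n. Riemann_sum f (D n)) I sequentially"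
  unfolding limitin_def
proof (intro conjI allI impI)
  fix U assume "openin tau U \<and> I \<in> U"
  then obtain d where d: "d > 0" "\<And>\<D>. mesh_less a b d \<D> \<Longrightarrow> Riemann_sum f \<D> \<in> U"
    using I unfolding has_Riemann_integral_iff by meson
  have "\<forall>\<^sub>F n in sequentially. inverse (real (Suc n)) < d"
    using LIMSEQ_inverse_real_of_nat d(1) by (rule order_tendstoD)
  then show "\<forall>\<^sub>F n in sequentially. Riemann_sum f (D n) \<in> U"
    by eventually_elim (use D mesh_less_mono d(2) less_imp_le in metis)
qed (use top in simp)

lemma Riemann_sum_linear:
  assumes "linear h" shows "h (Riemann_sum f \<D>) = Riemann_sum (\<lambda>s. h (f s)) \<D>"
  by (simp add: Riemann_sum_def linear_sum[OF assms] linear_scale[OF assms] split_def)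

context bicontinuous_space
begin

section \<open>Integrals of tau-continuous functions\<close>

lemma dual_continuous_on:
  assumes "\<phi> \<in> dual" "continuous_map (top_of_set S) tau f"
  shows "continuous_on S (\<lambda>t. \<phi> (f t))"
  using continuous_map_compose[OF assms(2) dual_continuous[OF assms(1)]] by (simp add: o_def)

lemma continuous_map_tendsto:
  assumes f: "continuous_map (top_of_set S) tau f" and t: "t \<in> S" and p: "p \<in> P"
  shows "((\<lambda>s. p (f s - f t)) \<longlongrightarrow> 0) (at t within S)"
proof -
  have "limitin (top_of_set S) (\<lambda>s. s) t (at t within S)"
    using t by (simp add: limitin_subtopology eventually_at_filter)
  then have "limitin tau f (f t) (at t within S)"
    using continuous_map_limit[OF f] by (simp add: o_def)
  then show ?thesis using p by (simp add: limitin_tau_iff)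
qed

text \<open>Heine-Cantor for one seminorm. Pairs of points violating uniformity have, along a
  subsequence, a common limit in the compact interval, where continuity is contradicted.\<close>

lemma uniform_modulus:
  fixes f :: "real \<Rightarrow> 'a"
  assumes f: "continuous_map (top_of_set {a..b}) tau f" and p: "p \<in> P" and e: "e > 0"
  shows "\<exists>d>0. \<forall>s\<in>{a..b}. \<forall>t\<in>{a..b}. \<bar>s - t\<bar> < d \<longrightarrow> p (f s - f t) \<le> e"
proof (rule ccontr)
  assume contra: "\<not> ?thesis"
  have "\<exists>s t. s \<in> {a..b} \<and> t \<in> {a..b} \<and> \<bar>s - t\<bar> < inverse (real (Suc n)) \<and> e < p (f s - f t)"
    for n
  proof -
    have pos: "inverse (real (Suc n)) > 0" by simp
    have "\<not> (\<forall>s\<in>{a..b}. \<forall>t\<in>{a..b}. \<bar>s - t\<bar> < inverse (real (Suc n)) \<longrightarrow> p (f s - f t) \<le> e)"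
      using contra pos by (auto simp del: of_nat_Suc)
    then show ?thesis by (simp only: not_le not_all not_imp bex_simps ball_simps) blast
  qed
  then obtain s t where st: "\<And>n. s n \<in> {a..b}" "\<And>n. t n \<in> {a..b}"
    "\<And>n. \<bar>s n - t n\<bar> < inverse (real (Suc n))" "\<And>n. e < p (f (s n) - f (t n))"
    by metis
  obtain l k where l: "l \<in> {a..b}" "strict_mono k" "(s \<circ> k) \<longlonglongrightarrow> l"
    using compact_Icc[of a b] st(1) unfolding compact_def by metis
  have "(\<lambda>n. s n - t n) \<longlonglongrightarrow> 0"
    by (rule tendsto_rabs_zero_cancel, rule tendsto_sandwich[OF _ _ tendsto_const LIMSEQ_inverse_real_of_nat])
      (use less_imp_le[OF st(3)] in auto)
  then have "(\<lambda>n. (s \<circ> k) n - ((\<lambda>n. s n - t n) \<circ> k) n) \<longlonglongrightarrow> l - 0"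
    by (intro tendsto_diff l(3) LIMSEQ_subseq_LIMSEQ l(2))
  then have t: "(t \<circ> k) \<longlonglongrightarrow> l" by (simp add: o_def)
  have cont: "continuous (at l within {a..b}) (\<lambda>r. p (f r - f l))"
    using continuous_map_tendsto[OF f l(1) p] p_0[OF p] by (simp add: continuous_within)
  have "(\<lambda>n. p (f ((s \<circ> k) n) - f l) + p (f ((t \<circ> k) n) - f l)) \<longlonglongrightarrow> p (f l - f l) + p (f l - f l)"
    by (intro tendsto_add continuous_within_tendsto_compose'[OF cont] l(3) t) (use st in auto)
  then have "(\<lambda>n. p (f ((s \<circ> k) n) - f l) + p (f ((t \<circ> k) n) - f l)) \<longlonglongrightarrow> 0"
    by (simp add: p_0[OF p])
  from order_tendstoD(2)[OF this e] obtain n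
    where n: "p (f (s (k n)) - f l) + p (f (t (k n)) - f l) < e"
    by (auto simp: eventually_sequentially)
  have "p (f (s (k n)) - f (t (k n))) \<le> p (f (s (k n)) - f l) + p (f l - f (t (k n)))"
    using p_add[OF p, of "f (s (k n)) - f l" "f l - f (t (k n))"] by simp
  then show False using n st(4)[of "k n"] p_minus_commute[OF p, of "f l"] by simp
qed

lemma Cauchy_in_tauI:
  assumes "\<And>p e. p \<in> P \<Longrightarrow> e > 0 \<Longrightarrow> \<exists>N. \<forall>m\<ge>N. \<forall>n\<ge>N. p (x m - x n) < e"
  shows "Cauchy_in tau x"
  unfolding Cauchy_in_def
proof (intro allI impI)
  fix U assume "openin tau U \<and> 0 \<in> U"
  then obtain G e where G: "finite G" "G \<subseteq> P" "e > 0" "{y. \<forall>p\<in>G. p (y - 0) < e} \<subseteq> U"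
    unfolding tau_eq openin_seminorm_topology by meson
  have "\<forall>p\<in>G. \<exists>N. \<forall>m\<ge>N. \<forall>n\<ge>N. p (x m - x n) < e"
    using assms G by blast
  then obtain N where N: "\<And>p m n. p \<in> G \<Longrightarrow> m \<ge> N p \<Longrightarrow> n \<ge> N p \<Longrightarrow> p (x m - x n) < e"
    by metis
  have "x m - x n \<in> U" if "m \<ge> Max (insert 0 (N ` G))" "n \<ge> Max (insert 0 (N ` G))" for m n
    using that G N by (intro subsetD[OF G(4)]) auto
  then show "\<exists>N. \<forall>m\<ge>N. \<forall>n\<ge>N. x m - x n \<in> U" by blast
qed

text \<open>Every estimate below is made for scalar functions first: the seminorm \<open>p x\<close> is attained
  at a functional dominated by \<open>p\<close>, and the modulus of continuity of a function for \<open>p\<close> serves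
  all these functionals simultaneously.\<close>

lemma Riemann_sum_seminorm_error:
  assumes f: "continuous_map (top_of_set {a..b}) tau f" and ab: "a \<le> b" and p: "p \<in> P"
    and e: "e > 0"
  shows "\<exists>d>0. \<forall>I. (\<forall>\<phi>\<in>dual. \<phi> I = integral {a..b} (\<lambda>s. \<phi> (f s))) \<longrightarrow>
           (\<forall>\<D>. mesh_less a b d \<D> \<longrightarrow> p (Riemann_sum f \<D> - I) < e)"
    (is "\<exists>d>0. ?I d")
    and "\<exists>d>0. \<forall>\<D> \<D>'. mesh_less a b d \<D> \<longrightarrow> mesh_less a b d \<D>' \<longrightarrow>
           p (Riemann_sum f \<D> - Riemann_sum f \<D>') < e"
    (is "\<exists>d>0. ?D d")
proof -
  \<comment> \<open>Two Riemann sums are each within \<open>e' * (b - a)\<close> of the integral, so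
    twice this error must be below \<open>e\<close>.\<close>
  define e' where "e' = e / 4 / (b - a + 1)"
  have pos: "b - a + 1 > 0" using ab by simp
  then have "e' * (b - a + 1) = e / 4"
    unfolding e'_def by (metis less_irrefl nonzero_eq_divide_eq)
  then have "2 * (e' * (b - a + 1)) < e" using e by linarith
  moreover have "e' > 0" using pos e by (simp add: e'_def)
  ultimately have e': "e' > 0" "2 * (e' * (b - a)) < e" by (simp_all add: distrib_left)
  obtain d where d: "d > 0"
    "\<And>s t. s \<in> {a..b} \<Longrightarrow> t \<in> {a..b} \<Longrightarrow> \<bar>s - t\<bar> < d \<Longrightarrow> p (f s - f t) \<le> e'"
    using uniform_modulus[OF f p e'(1)] by blast
  have *: "norm (\<phi> (Riemann_sum f \<D>) - integral {a..b} (\<lambda>s. \<phi> (f s))) \<le> e' * (b - a)"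
    if \<phi>: "\<phi> \<in> dual" "\<And>z. norm (\<phi> z) \<le> p z" and D: "mesh_less a b d \<D>" for \<phi> \<D>
    unfolding Riemann_sum_linear[OF dual_linear[OF \<phi>(1)]]
  proof (rule Riemann_sum_error[OF dual_continuous_on[OF \<phi>(1) f] ab _ _ D])
    show "norm (\<phi> (f s) - \<phi> (f t)) \<le> e'" if "s \<in> {a..b}" "t \<in> {a..b}" "\<bar>s - t\<bar> < d" for s t
      using \<phi>(2)[of "f s - f t"] d(2)[OF that] by (simp add: dual_diff[OF \<phi>(1)])
  qed (use e' in simp)
  have "?I d"
  proof (intro allI impI)
    fix I \<D> assume I: "\<forall>\<phi>\<in>dual. \<phi> I = integral {a..b} (\<lambda>s. \<phi> (f s))" and D: "mesh_less a b d \<D>"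
    have "p (Riemann_sum f \<D> - I) \<le> e' * (b - a)"
      by (rule seminorm_le_if_dual[OF p]) (use * D I in \<open>simp add: dual_diff\<close>)
    moreover have "0 \<le> e' * (b - a)" using e' ab by simp
    ultimately show "p (Riemann_sum f \<D> - I) < e" using e'(2) by linarith
  qed
  then show "\<exists>d>0. ?I d" using d(1) by blast
  have "?D d"
  proof (intro allI impI)
    fix \<D> \<D>' assume D: "mesh_less a b d \<D>" "mesh_less a b d \<D>'"
    have "p (Riemann_sum f \<D> - Riemann_sum f \<D>') \<le> 2 * (e' * (b - a))"
    proof (rule seminorm_le_if_dual[OF p])
      fix \<phi> assume \<phi>: "\<phi> \<in> dual" "\<And>z. norm (\<phi> z) \<le> p z"
      show "norm (\<phi> (Riemann_sum f \<D> - Riemann_sum f \<D>')) \<le> 2 * (e' * (b - a))"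
        unfolding dual_diff[OF \<phi>(1)] using norm_triangle_ineq4[of "\<phi> (Riemann_sum f \<D>) - integral {a..b} (\<lambda>s. \<phi> (f s))"
              "\<phi> (Riemann_sum f \<D>') - integral {a..b} (\<lambda>s. \<phi> (f s))"]
            *[OF \<phi> D(1)] *[OF \<phi> D(2)] by simp
    qed
    then show "p (Riemann_sum f \<D> - Riemann_sum f \<D>') < e" using e'(2) by linarith
  qed
  then show "\<exists>d>0. ?D d" using d(1) by blast
qed

text \<open>The Riemann sums along a sequence of ever finer divisions are Cauchy, and
  \<open>B\<close> makes them norm-bounded, as the completeness hypothesis demands.\<close>

lemma Riemann_integral_exists:
  assumes f: "continuous_map (top_of_set {a..b}) tau f" and ab: "a \<le> b"
    and B: "\<And>s. s \<in> {a..b} \<Longrightarrow> norm (f s) \<le> B"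
  shows "\<exists>I. has_Riemann_integral tau f I a b"
proof -
  have "\<exists>\<D>. mesh_less a b (inverse (real (Suc n))) \<D>" for n
    by (rule mesh_less_exists) simp
  then obtain D where D: "\<And>n. mesh_less a b (inverse (real (Suc n))) (D n)" by metis
  define S where "S n = Riemann_sum f (D n)" for n
  have "bounded (range S)"
    unfolding bounded_iff S_def using norm_Riemann_sum_le[OF D ab, of f B] B by auto
  moreover have "Cauchy_in tau S"
  proof (rule Cauchy_in_tauI)
    fix p e assume p: "p \<in> P" and e: "(e::real) > 0"
    obtain d where d: "d > 0" "\<And>\<D> \<D>'. mesh_less a b d \<D> \<Longrightarrow> mesh_less a b d \<D>' \<Longrightarrow>
      p (Riemann_sum f \<D> - Riemann_sum f \<D>') < e"
      using Riemann_sum_seminorm_error(2)[OF f ab p e] by blast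
    have "\<forall>\<^sub>F n in sequentially. inverse (real (Suc n)) < d"
      using LIMSEQ_inverse_real_of_nat d(1) by (rule order_tendstoD)
    then obtain N where "\<And>n. n \<ge> N \<Longrightarrow> inverse (real (Suc n)) < d"
      unfolding eventually_sequentially by blast
    then have "mesh_less a b d (D n)" if "n \<ge> N" for n
      using mesh_less_mono[OF D] that less_imp_le by metis
    then show "\<exists>N. \<forall>m\<ge>N. \<forall>n\<ge>N. p (S m - S n) < e"
      unfolding S_def using d(2) by blast
  qed
  ultimately obtain I where I: "limitin tau S I sequentially"
    using bounded_Cauchy_limit by blast
  \<comment> \<open>Once all functionals identify the sequential limit with the scalar integral, the
    error estimate holds for every fine division and not only for those of the sequence.\<close>
  have \<phi>I: "\<phi> I = integral {a..b} (\<lambda>s. \<phi> (f s))" if \<phi>: "\<phi> \<in> dual" for \<phi>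
    using LIMSEQ_unique[OF dual_tendsto[OF \<phi> I[unfolded S_def]]
        Riemann_sums_tendsto_integral[OF dual_continuous_on[OF \<phi> f] ab D, folded Riemann_sum_linear[OF dual_linear[OF \<phi>]]]] .
  have "has_Riemann_integral tau f I a b"
    unfolding has_Riemann_integral_iff
  proof (intro allI impI)
    fix U assume "openin tau U \<and> I \<in> U"
    then obtain G e where G: "finite G" "G \<subseteq> P" "e > 0" "{y. \<forall>p\<in>G. p (y - I) < e} \<subseteq> U"
      unfolding tau_eq openin_seminorm_topology by meson
    have "\<forall>p\<in>G. \<exists>d>0. \<forall>\<D>. mesh_less a b d \<D> \<longrightarrow> p (Riemann_sum f \<D> - I) < e"
    proof
      fix p assume "p \<in> G"
      then have "p \<in> P" using G(2) by blast
      from Riemann_sum_seminorm_error(1)[OF f ab this G(3)] \<phi>I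
      show "\<exists>d>0. \<forall>\<D>. mesh_less a b d \<D> \<longrightarrow> p (Riemann_sum f \<D> - I) < e" by metis
    qed
    then obtain d where d: "\<And>p. p \<in> G \<Longrightarrow> d p > 0"
      "\<And>p \<D>. p \<in> G \<Longrightarrow> mesh_less a b (d p) \<D> \<Longrightarrow> p (Riemann_sum f \<D> - I) < e"
      by metis
    \<comment> \<open>The inserted 1 keeps the minimum meaningful for empty
      \<open>G\<close>.\<close>
    define m where "m = Min (insert 1 (d ` G))"
    have m: "m > 0" "\<And>p. p \<in> G \<Longrightarrow> m \<le> d p" using G(1) d(1) by (auto simp: m_def)
    have "Riemann_sum f \<D> \<in> U" if "mesh_less a b m \<D>" for \<D>
      using d(2) mesh_less_mono[OF that m(2)] by (intro subsetD[OF G(4)]) auto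
    then show "\<exists>d>0. \<forall>\<D>. mesh_less a b d \<D> \<longrightarrow> Riemann_sum f \<D> \<in> U" using m(1) by blast
  qed
  then show ?thesis ..
qed

lemma Riemann_integral_dual:
  assumes I: "has_Riemann_integral tau f I a b" and \<phi>: "\<phi> \<in> dual"
    and f: "continuous_map (top_of_set {a..b}) tau f" and ab: "a \<le> b"
  shows "\<phi> I = integral {a..b} (\<lambda>s. \<phi> (f s))"
proof -
  have "\<exists>\<D>. mesh_less a b (inverse (real (Suc n))) \<D>" for n
    by (rule mesh_less_exists) simp
  then obtain D where D: "\<And>n. mesh_less a b (inverse (real (Suc n))) (D n)" by metis
  show ?thesis
    using LIMSEQ_unique[OF dual_tendsto[OF \<phi> has_Riemann_integral_limitin[OF I topspace_tau D]]
        Riemann_sums_tendsto_integral[OF dual_continuous_on[OF \<phi> f] ab D, folded Riemann_sum_linear[OF dual_linear[OF \<phi>]]]] .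
qed

lemma Riemann_integral_unique:
  assumes "has_Riemann_integral tau f I a b" "has_Riemann_integral tau f J a b"
    and "continuous_map (top_of_set {a..b}) tau f" "a \<le> b"
  shows "I = J"
  by (rule dual_separates) (simp add: Riemann_integral_dual[OF assms(1)] Riemann_integral_dual[OF assms(2)] assms)

end

text \<open>The semigroup identities hold at nonnegative times only; this suffices since the tags
  lie in the interval.\<close>

lemma Riemann_sum_cong:
  assumes "mesh_less a b d \<D>" "\<And>s. s \<in> {a..b} \<Longrightarrow> f s = g s"
  shows "Riemann_sum f \<D> = Riemann_sum g \<D>"
  unfolding Riemann_sum_def
proof (rule sum.cong, simp, safe)
  fix s K assume sK: "(s, K) \<in> \<D>"
  have "\<D> tagged_division_of {a..b}" using assms(1) by (simp add: mesh_less_def)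
  then have "s \<in> {a..b}" using tagged_division_ofD(2,3)[OF _ sK] by blast
  then show "measure lborel K *\<^sub>R f s = measure lborel K *\<^sub>R g s" by (simp add: assms(2))
qed

lemma limitin_compose_filterlim:
  "limitin X f l G \<Longrightarrow> filterlim g G F \<Longrightarrow> limitin X (\<lambda>x. f (g x)) l F"
  by (auto simp: limitin_def filterlim_iff)

context bicontinuous_space
begin

section \<open>Uniqueness of limits, weak limits and consequences of separation\<close>

lemma limitin_tau_unique:
  assumes "limitin tau f l F" "limitin tau f m F" "F \<noteq> bot"
  shows "l = m"
proof (rule dual_separates)
  fix \<phi> assume \<phi>: "\<phi> \<in> dual"
  show "\<phi> l = \<phi> m"
    by (rule tendsto_unique[OF assms(3) dual_tendsto[OF \<phi> assms(1)] dual_tendsto[OF \<phi> assms(2)]])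
qed

lemma limitin_weak_topology_iff:
  "limitin (weak_topology scl tau) f l F \<longleftrightarrow> (\<forall>\<phi>\<in>dual. ((\<lambda>i. \<phi> (f i)) \<longlongrightarrow> \<phi> l) F)"
proof -
  have "limitin (weak_topology scl tau) f l F \<longleftrightarrow>
      (\<forall>q\<in>{\<lambda>x. norm (\<phi> x) | \<phi>. \<phi> \<in> dual}. ((\<lambda>i. q (f i - l)) \<longlongrightarrow> 0) F)"
    unfolding weak_topology_def
    by (rule limitin_seminorm_topology) (auto simp: dual_add dual_0 norm_triangle_ineq)
  also have "\<dots> \<longleftrightarrow> (\<forall>\<phi>\<in>dual. ((\<lambda>i. norm (\<phi> (f i - l))) \<longlongrightarrow> 0) F)"
    by fastforce
  also have "\<dots> \<longleftrightarrow> (\<forall>\<phi>\<in>dual. ((\<lambda>i. \<phi> (f i)) \<longlongrightarrow> \<phi> l) F)"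
    by (intro ball_cong refl) (simp add: dual_diff tendsto_norm_zero_iff LIM_zero_iff)
  finally show ?thesis .
qed

text \<open>A point outside the closure has a basic neighbourhood missing \<open>H\<close>. The sum
  of its finitely many seminorms is then at least \<open>e\<close> on all differences with
  \<open>H\<close>, and separation yields a half-space that contains \<open>H\<close> but not the
  point.\<close>

lemma closure_of_tau_inner:
  assumes H: "convex H" "H \<noteq> {}"
    and y: "\<And>\<phi> K. \<phi> \<in> dual \<Longrightarrow> (\<And>c. c \<in> H \<Longrightarrow> inner (\<phi> c) 1 \<le> K) \<Longrightarrow> inner (\<phi> y) 1 \<le> K"
  shows "y \<in> tau closure_of H"
proof (rule ccontr)
  assume "y \<notin> tau closure_of H"
  then obtain U where U: "y \<in> U" "openin tau U" "H \<inter> U = {}"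
    by (auto simp: in_closure_of)
  then obtain G e where G: "finite G" "G \<subseteq> P" "e > 0" "{z. \<forall>p\<in>G. p (z - y) < e} \<subseteq> U"
    unfolding tau_eq openin_seminorm_topology by meson
  have "e \<le> (\<Sum>p\<in>G. p (y - c))" if c: "c \<in> H" for c
  proof -
    have "c \<notin> {z. \<forall>p\<in>G. p (z - y) < e}" using c U(3) G(4) by blast
    then obtain p where p: "p \<in> G" "e \<le> p (c - y)" by force
    then have "e \<le> p (y - c)" using G(2) p_minus_commute[of p y c] by auto
    also have "\<dots> \<le> (\<Sum>p\<in>G. p (y - c))"
      using G p by (intro member_le_sum) (auto intro: p_nonneg)
    finally show ?thesis .
  qed
  then obtain \<phi> where \<phi>: "\<phi> \<in> dual" "\<And>c. c \<in> H \<Longrightarrow> inner (\<phi> c) 1 + e \<le> inner (\<phi> y) 1"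
    using dual_separation[OF H G(1,2), of e y] G(3) by auto
  have "inner (\<phi> c) 1 \<le> inner (\<phi> y) 1 - e" if "c \<in> H" for c
    using \<phi>(2)[OF that] by linarith
  then have "inner (\<phi> y) 1 \<le> inner (\<phi> y) 1 - e" by (rule y[OF \<phi>(1)])
  then show False using G(3) by simp
qed

lemma dual_vanishing:
  assumes L: "\<And>c x. x \<in> L \<Longrightarrow> scl c x \<in> L" "\<And>x y. x \<in> L \<Longrightarrow> y \<in> L \<Longrightarrow> x + y \<in> L" "0 \<in> L"
    and p: "p \<in> P" and e: "e > 0" "\<And>c. c \<in> L \<Longrightarrow> e \<le> p (x - c)"
  shows "\<exists>\<phi>\<in>dual. (\<forall>c\<in>L. \<phi> c = 0) \<and> \<phi> x \<noteq> 0"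
proof -
  have "r *\<^sub>R z \<in> L" if "z \<in> L" for r z
    using L(1)[OF that, of "of_real r"] by (simp add: banach_scaling_of_real[OF scl])
  then have "convex L" unfolding convex_def using L(2) by blast
  then obtain \<phi> where \<phi>: "\<phi> \<in> dual" "\<And>c. c \<in> L \<Longrightarrow> inner (\<phi> c) 1 + e \<le> inner (\<phi> x) 1"
    using dual_separation[of L "{p}" e x] p e L(3) by fastforce
  have "\<phi> c = 0" if c: "c \<in> L" for c
  proof (rule ccontr)
    assume ne: "\<phi> c \<noteq> 0"
    \<comment> \<open>A nonzero value on the subspace could be rescaled to the real part of the
      value at \<open>x\<close>, leaving no room for the margin.\<close>
    define k where "k = inner (\<phi> x) 1 *\<^sub>R inverse (\<phi> c)"
    have "\<phi> (scl k c) = inner (\<phi> x) 1 *\<^sub>R 1"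
      using ne by (simp add: dual_scl[OF \<phi>(1)] k_def)
    then have "inner (\<phi> (scl k c)) 1 = inner (\<phi> x) 1"
      by (simp add: dot_square_norm)
    then show False using \<phi>(2)[OF L(1)[OF c, of k]] e(1) by simp
  qed
  moreover have "\<phi> x \<noteq> 0" using \<phi>(2)[OF L(3)] e(1) by (auto simp: dual_0[OF \<phi>(1)])
  ultimately show ?thesis using \<phi>(1) by blast
qed

end

section \<open>Bi-continuous contraction semigroups\<close>

locale contraction_bicontinuous = bicontinuous_space scl tau P
  for scl :: "'k::{real_normed_field,euclidean_space} \<Rightarrow> 'a::banach \<Rightarrow> 'a" and tau P +
  fixes T :: "real \<Rightarrow> 'a \<Rightarrow> 'a"
  assumes semigroup: "bicontinuous_semigroup scl tau T"
    and contraction: "contraction_semigroup T"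
begin

lemma T_0 [simp]: "T 0 x = x"
  using semigroup by (simp add: bicontinuous_semigroup_def)

lemma T_add: "0 \<le> t \<Longrightarrow> 0 \<le> s \<Longrightarrow> T (t + s) x = T t (T s x)"
  using semigroup by (simp add: bicontinuous_semigroup_def)

lemma T_commute: "0 \<le> t \<Longrightarrow> 0 \<le> s \<Longrightarrow> T t (T s x) = T s (T t x)"
  by (metis T_add add.commute)

lemma T_plus: "0 \<le> t \<Longrightarrow> T t (x + y) = T t x + T t y"
  and T_scl: "0 \<le> t \<Longrightarrow> T t (scl c x) = scl c (T t x)"
  using semigroup
  by (auto simp: bicontinuous_semigroup_def bounded_operator_def Vector_Spaces.linear_iff)

lemma T_bounded_linear:
  assumes t: "0 \<le> t"
  shows "bounded_linear (T t)"
proof -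
  obtain B where B: "\<And>x. norm (T t x) \<le> B * norm x"
    using semigroup t unfolding bicontinuous_semigroup_def bounded_operator_def by meson
  have "T t (r *\<^sub>R x) = r *\<^sub>R T t x" for r x
    using T_scl[OF t, of "of_real r" x] by (simp add: banach_scaling_of_real[OF scl])
  then show ?thesis
    using B T_plus[OF t] by (intro bounded_linear_intro[where K = B]) (simp_all add: mult.commute)
qed

lemmas T_linear = bounded_linear.linear[OF T_bounded_linear]

lemma norm_T_le: "0 \<le> t \<Longrightarrow> norm (T t x) \<le> norm x"
  using onorm[OF T_bounded_linear, of t x] contraction
    mult_right_mono[of "onorm (T t)" 1 "norm x"] by (simp add: contraction_semigroup_def)

lemma T_continuous_map:
  assumes S: "S \<subseteq> {0..}"
  shows "continuous_map (top_of_set S) tau (\<lambda>t. T t x)"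
proof (rule continuous_map_from_subtopology_mono[OF _ S])
  show "continuous_map (top_of_set {0..}) tau (\<lambda>t. T t x)"
    using semigroup unfolding bicontinuous_semigroup_def by blast
qed

lemma dual_T_continuous_on: "\<phi> \<in> dual \<Longrightarrow> S \<subseteq> {0..} \<Longrightarrow> continuous_on S (\<lambda>s. \<phi> (T s x))"
  using dual_continuous_on[OF _ T_continuous_map] .

lemma dual_T_integrable: "\<phi> \<in> dual \<Longrightarrow> 0 \<le> a \<Longrightarrow> (\<lambda>s. \<phi> (T s x)) integrable_on {a..b}"
  by (intro integrable_continuous_real dual_T_continuous_on) auto

lemma T_limit_uniform:
  assumes "bounded (range y)" "limitin tau y l sequentially" "0 \<le> b" "p \<in> P" "0 < e"
  shows "\<forall>\<^sub>F n in sequentially. \<forall>t\<in>{0..b}. p (T t (y n) - T t l) < e"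
proof -
  have "openin tau {z. p (z - 0) < e}"
    unfolding tau_eq using assms(4) by (rule openin_seminorm_topology_ball) (rule p_add[OF assms(4)])
  moreover have "0 \<in> {z. p (z - 0) < e}" using assms(5) p_0[OF assms(4)] by simp
  ultimately have "\<forall>\<^sub>F n in sequentially. \<forall>t\<in>{0..b}. T t (y n) - T t l \<in> {z. p (z - 0) < e}"
    using semigroup assms(1-3) unfolding bicontinuous_semigroup_def by meson
  then show ?thesis by simp
qed

lemma T_limit:
  assumes "bounded (range y)" "limitin tau y l sequentially" "0 \<le> t"
  shows "limitin tau (\<lambda>n. T t (y n)) (T t l) sequentially"
  unfolding limitin_tau_iff
proof
  fix p assume p: "p \<in> P"
  show "(\<lambda>n. p (T t (y n) - T t l)) \<longlonglongrightarrow> 0"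
  proof (rule tendstoI)
    fix e :: real assume "e > 0"
    from T_limit_uniform[OF assms p this]
    show "\<forall>\<^sub>F n in sequentially. dist (p (T t (y n) - T t l)) 0 < e"
      by eventually_elim (use assms(3) p_nonneg[OF p] in \<open>auto simp: dist_real_def\<close>)
  qed
qed

section \<open>Integrals of orbits\<close>

definition J :: "real \<Rightarrow> 'a \<Rightarrow> 'a" where
  "J r x = (THE I. has_Riemann_integral tau (\<lambda>s. T s x) I 0 r)"

lemma cesaro_eq: "cesaro tau T r x = (1 / r) *\<^sub>R J r x"
  by (simp add: cesaro_def J_def)

lemma J_Riemann: "0 \<le> r \<Longrightarrow> has_Riemann_integral tau (\<lambda>s. T s x) (J r x) 0 r"
proof -
  assume r: "0 \<le> r"
  have cont: "continuous_map (top_of_set {0..r}) tau (\<lambda>s. T s x)"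
    by (rule T_continuous_map) auto
  obtain I where I: "has_Riemann_integral tau (\<lambda>s. T s x) I 0 r"
    using Riemann_integral_exists[OF cont r, of "norm x"] norm_T_le by auto
  show ?thesis
    unfolding J_def
    by (rule theI[of "\<lambda>I. has_Riemann_integral tau (\<lambda>s. T s x) I 0 r", OF I])
      (rule Riemann_integral_unique[OF _ I cont r])
qed

lemma J_dual: "0 \<le> r \<Longrightarrow> \<phi> \<in> dual \<Longrightarrow> \<phi> (J r x) = integral {0..r} (\<lambda>s. \<phi> (T s x))"
  by (rule Riemann_integral_dual[OF J_Riemann]) (auto intro: T_continuous_map)

lemma J_plus:
  assumes r: "0 \<le> r"
  shows "J r (x + y) = J r x + J r y"
proof (rule dual_separates)
  fix \<phi> assume \<phi>: "\<phi> \<in> dual"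
  have "integral {0..r} (\<lambda>s. \<phi> (T s (x + y))) = integral {0..r} (\<lambda>s. \<phi> (T s x) + \<phi> (T s y))"
    by (rule integral_cong) (simp add: T_plus dual_add[OF \<phi>])
  also have "\<dots> = integral {0..r} (\<lambda>s. \<phi> (T s x)) + integral {0..r} (\<lambda>s. \<phi> (T s y))"
    by (rule integral_add) (simp_all add: dual_T_integrable[OF \<phi>])
  finally show "\<phi> (J r (x + y)) = \<phi> (J r x + J r y)"
    by (simp add: J_dual[OF r \<phi>] dual_add[OF \<phi>])
qed

lemma J_scl:
  assumes r: "0 \<le> r"
  shows "J r (scl c x) = scl c (J r x)"
proof (rule dual_separates)
  fix \<phi> assume \<phi>: "\<phi> \<in> dual"
  have "integral {0..r} (\<lambda>s. \<phi> (T s (scl c x))) = integral {0..r} (\<lambda>s. c * \<phi> (T s x))"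
    by (rule integral_cong) (simp add: T_scl dual_scl[OF \<phi>])
  also have "\<dots> = c * integral {0..r} (\<lambda>s. \<phi> (T s x))"
    by (rule integral_linear[OF dual_T_integrable[OF \<phi>] bounded_linear_mult_right, unfolded o_def]) simp
  finally show "\<phi> (J r (scl c x)) = \<phi> (scl c (J r x))"
    by (simp add: J_dual[OF r \<phi>] dual_scl[OF \<phi>])
qed

lemma J_linear: "0 \<le> r \<Longrightarrow> linear (J r)"
proof (rule linearI)
  assume r: "0 \<le> r"
  show "J r (x + y) = J r x + J r y" for x y using J_plus[OF r] .
  show "J r (a *\<^sub>R x) = a *\<^sub>R J r x" for a x
    using J_scl[OF r, of "of_real a" x] by (simp add: banach_scaling_of_real[OF scl])
qed

lemma J_dual_bound:
  assumes "0 \<le> r" "\<phi> \<in> dual" "\<And>s. s \<in> {0..r} \<Longrightarrow> norm (\<phi> (T s x)) \<le> K"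
  shows "norm (\<phi> (J r x)) \<le> K * r"
  using integral_bound[of 0 r "\<lambda>s. \<phi> (T s x)" K] assms dual_T_continuous_on[OF assms(2), of "{0..r}" x]
  by (simp add: J_dual)

lemma J_seminorm_bound:
  assumes "0 \<le> r" "p \<in> P" "\<And>s. s \<in> {0..r} \<Longrightarrow> p (T s x) \<le> K"
  shows "p (J r x) \<le> K * r"
proof (rule seminorm_le_if_dual[OF assms(2)])
  fix \<phi> assume \<phi>: "\<phi> \<in> dual" "\<And>z. norm (\<phi> z) \<le> p z"
  show "norm (\<phi> (J r x)) \<le> K * r"
    by (rule J_dual_bound[OF assms(1) \<phi>(1)]) (rule order_trans[OF \<phi>(2) assms(3)])
qed

lemma norm_J_le: "0 \<le> r \<Longrightarrow> norm (J r x) \<le> norm x * r"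
proof (rule norm_le_if_dual)
  fix \<phi> assume r: "0 \<le> r" and \<phi>: "\<phi> \<in> dual" "onorm \<phi> \<le> 1"
  show "norm (\<phi> (J r x)) \<le> norm x * r"
    by (rule J_dual_bound[OF r \<phi>(1)], rule order_trans[OF norm_dual_le[OF \<phi>] norm_T_le]) simp
qed

text \<open>The operators \<open>T h\<close> need not be \<open>\<tau>\<close>-continuous, but they are sequentially so on bounded
  sets, and the integral is the limit of a bounded sequence of Riemann sums.\<close>

lemma T_J: "0 \<le> h \<Longrightarrow> 0 \<le> r \<Longrightarrow> T h (J r x) = J r (T h x)"
proof -
  assume h: "0 \<le> h" and r: "0 \<le> r"
  have "\<exists>\<D>. mesh_less 0 r (inverse (real (Suc n))) \<D>" for n
    by (rule mesh_less_exists) simp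
  then obtain D where D: "\<And>n. mesh_less 0 r (inverse (real (Suc n))) (D n)" by metis
  have "norm (Riemann_sum (\<lambda>s. T s x) (D n)) \<le> norm x * (r - 0)" for n
    by (rule norm_Riemann_sum_le[OF D r]) (simp add: norm_T_le)
  then have "bounded (range (\<lambda>n. Riemann_sum (\<lambda>s. T s x) (D n)))"
    unfolding bounded_iff by auto
  then have "limitin tau (\<lambda>n. T h (Riemann_sum (\<lambda>s. T s x) (D n))) (T h (J r x)) sequentially"
    by (rule T_limit[OF _ has_Riemann_integral_limitin[OF J_Riemann[OF r] topspace_tau D] h])
  moreover have "T h (Riemann_sum (\<lambda>s. T s x) (D n)) = Riemann_sum (\<lambda>s. T s (T h x)) (D n)" for n
    unfolding Riemann_sum_linear[OF T_linear[OF h]]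
    by (rule Riemann_sum_cong[OF D]) (simp add: T_commute h)
  ultimately have "limitin tau (\<lambda>n. Riemann_sum (\<lambda>s. T s (T h x)) (D n)) (T h (J r x)) sequentially"
    by simp
  then show ?thesis
    by (rule limitin_tau_unique)
      (use has_Riemann_integral_limitin[OF J_Riemann[OF r] topspace_tau D] in auto)
qed

text \<open>By \<open>T_J\<close> the operator \<open>T h\<close> goes inside the integral, and
  every term becomes an integral of the single function \<open>g\<close> over a part of [0, r + h].
  Splitting that interval once at h and once at r gives the two sides.\<close>

lemma T_J_diff:
  assumes h: "0 \<le> h" and r: "0 \<le> r"
  shows "T h (J r x) - J r x = J h (T r x - x)"
proof (rule dual_separates)
  fix \<phi> assume \<phi>: "\<phi> \<in> dual"
  define g where "g s = \<phi> (T s x)" for s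
  have shift: "\<phi> (J a (T b x)) = integral {b..a + b} g" if "0 \<le> a" "0 \<le> b" for a b
  proof -
    have "\<phi> (J a (T b x)) = integral {0..a} (g \<circ> (+) b)"
      unfolding J_dual[OF that(1) \<phi>]
      by (rule integral_cong) (use that(2) in \<open>simp add: g_def T_add T_commute\<close>)
    then show ?thesis by (simp add: integral_shift_Icc_real)
  qed
  have int: "g integrable_on {0..b}" for b
    unfolding g_def using dual_T_integrable[OF \<phi>] by simp
  have 1: "integral {0..h} g + integral {h..r + h} g = integral {0..r + h} g"
    by (rule Henstock_Kurzweil_Integration.integral_combine; use h r int in simp)
  have 2: "integral {0..r} g + integral {r..h + r} g = integral {0..h + r} g"
    by (rule Henstock_Kurzweil_Integration.integral_combine; use h r int in simp)
  have 3: "\<phi> (J h x) = integral {0..h} g" "\<phi> (J r x) = integral {0..r} g"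
    using J_dual[OF h \<phi>] J_dual[OF r \<phi>] by (simp_all add: g_def[abs_def])
  have "\<phi> (T h (J r x) - J r x) = integral {h..r + h} g - integral {0..r} g"
    by (simp add: T_J[OF h r] dual_diff[OF \<phi>] shift[OF r h] 3)
  also have "\<dots> = integral {r..h + r} g - integral {0..h} g"
    using 1 2 by (simp add: add.commute algebra_simps)
  also have "\<dots> = \<phi> (J h (T r x - x))"
    by (simp add: linear_diff[OF J_linear[OF h]] dual_diff[OF \<phi>] shift[OF h r] 3)
  finally show "\<phi> (T h (J r x) - J r x) = \<phi> (J h (T r x - x))" .
qed

text \<open>Averages over short intervals approach the initial value, because the orbit is
  tau-continuous at 0. The bound e/2 leaves room for a strict inequality.\<close>

lemma J_derivative: "limitin tau (\<lambda>h. J h x /\<^sub>R h) x (at_right 0)"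
  unfolding limitin_tau_iff
proof
  fix p assume p: "p \<in> P"
  show "((\<lambda>h. p (J h x /\<^sub>R h - x)) \<longlongrightarrow> 0) (at_right 0)"
  proof (rule tendstoI)
    fix e :: real assume e: "e > 0"
    have "((\<lambda>s. p (T s x - T 0 x)) \<longlongrightarrow> 0) (at 0 within {0..})"
      by (rule continuous_map_tendsto[OF T_continuous_map _ p]) auto
    then have "\<forall>\<^sub>F s in at 0 within {0..}. p (T s x - T 0 x) < e / 2"
      by (rule order_tendstoD) (use e in simp)
    then obtain d where d: "d > 0" "\<And>s. 0 < s \<Longrightarrow> s < d \<Longrightarrow> p (T s x - x) < e / 2"
      unfolding eventually_at by (auto simp: dist_real_def)
    have "p (J h x /\<^sub>R h - x) < e" if h: "0 < h" "h < d" for h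
    proof -
      have "p (J h x /\<^sub>R h - x) \<le> e / 2"
      proof (rule seminorm_le_if_dual[OF p])
        fix \<phi> assume \<phi>: "\<phi> \<in> dual" "\<And>z. norm (\<phi> z) \<le> p z"
        have 1: "norm (integral {0..h} (\<lambda>s. \<phi> (T s x) - \<phi> x)) \<le> e / 2 * (h - 0)"
        proof (rule integral_bound)
          show "continuous_on {0..h} (\<lambda>s. \<phi> (T s x) - \<phi> x)"
            by (intro continuous_intros dual_T_continuous_on[OF \<phi>(1)]) auto
          show "norm (\<phi> (T s x) - \<phi> x) \<le> e / 2" if "s \<in> {0..h}" for s
          proof (cases "s = 0")
            case False
            then have "p (T s x - x) < e / 2" using d(2)[of s] that h by auto
            then show ?thesis using \<phi>(2)[of "T s x - x"] by (simp add: dual_diff[OF \<phi>(1)])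
          qed (use e in simp)
        qed (use h in simp)
        have "integral {0..h} (\<lambda>s. \<phi> (T s x) - \<phi> x)
            = integral {0..h} (\<lambda>s. \<phi> (T s x)) - integral {0..h} (\<lambda>s. \<phi> x)"
          by (rule integral_diff[OF dual_T_integrable[OF \<phi>(1)] integrable_const_ivl]) simp
        then have 2: "integral {0..h} (\<lambda>s. \<phi> (T s x) - \<phi> x) = \<phi> (J h x) - h *\<^sub>R \<phi> x"
          using h by (simp add: J_dual[OF _ \<phi>(1)])
        have 3: "\<phi> (J h x /\<^sub>R h - x) = (\<phi> (J h x) - h *\<^sub>R \<phi> x) /\<^sub>R h"
          using h by (simp add: dual_diff[OF \<phi>(1)] dual_scaleR[OF \<phi>(1)] scaleR_diff_right)
        have "norm (\<phi> (J h x /\<^sub>R h - x)) = norm (\<phi> (J h x) - h *\<^sub>R \<phi> x) / h"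
          unfolding 3 norm_scaleR using h(1) by (simp add: divide_inverse mult.commute)
        moreover have "norm (\<phi> (J h x) - h *\<^sub>R \<phi> x) \<le> e / 2 * h"
          using 1 unfolding 2 by simp
        ultimately show "norm (\<phi> (J h x /\<^sub>R h - x)) \<le> e / 2"
          using h(1) by (simp only: pos_divide_le_eq)
      qed
      then show ?thesis using e by simp
    qed
    then show "\<forall>\<^sub>F h in at_right 0. dist (p (J h x /\<^sub>R h - x)) 0 < e"
      unfolding eventually_at_right_field using d(1) p_nonneg[OF p]
      by (auto simp: dist_real_def)
  qed
qed

section \<open>The generator and the two kernels\<close>

lemma gen_eqI:
  assumes "limitin tau (\<lambda>t. (T t x - x) /\<^sub>R t) y (at_right 0)"
  shows "gen tau T x = y"
  unfolding gen_def
proof (rule the_equality)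
  show "z = y" if "limitin tau (\<lambda>t. (T t x - x) /\<^sub>R t) z (at_right 0)" for z
    using limitin_tau_unique[OF that assms] by simp
qed (rule assms)

lemma gen_domainI:
  assumes "\<And>t. t \<in> {0<..<1} \<Longrightarrow> norm ((T t x - x) /\<^sub>R t) \<le> B"
    and "limitin tau (\<lambda>t. (T t x - x) /\<^sub>R t) y (at_right 0)"
  shows "x \<in> gen_domain tau T"
  unfolding gen_domain_def mem_Collect_eq
  by (intro conjI exI[of _ y] assms(2) bdd_aboveI2[where M = B] assms(1))

text \<open>The difference quotient of \<open>J r x\<close> is the average over [0, t] of the orbit
  of \<open>T r x - x\<close>. \<open>J_derivative\<close> gives its limit and contractivity its
  norm bound.\<close>

lemma J_gen:
  assumes r: "0 \<le> r"
  shows "limitin tau (\<lambda>t. (T t (J r x) - J r x) /\<^sub>R t) (T r x - x) (at_right 0)"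
    and "J r x \<in> gen_domain tau T"
proof -
  have eq: "(T t (J r x) - J r x) /\<^sub>R t = J t (T r x - x) /\<^sub>R t" if "0 < t" for t
    using T_J_diff[OF _ r, of t x] that by simp
  have "\<forall>\<^sub>F t in at_right 0. J t (T r x - x) /\<^sub>R t = (T t (J r x) - J r x) /\<^sub>R t"
    unfolding eventually_at_right_field using eq by (intro exI[of _ 1]) simp
  then show lim: "limitin tau (\<lambda>t. (T t (J r x) - J r x) /\<^sub>R t) (T r x - x) (at_right 0)"
    by (rule limitin_transform_eventually[OF _ J_derivative])
  have "norm ((T t (J r x) - J r x) /\<^sub>R t) \<le> norm (T r x - x)" if "t \<in> {0<..<1}" for t
  proof -
    have "norm (J t (T r x - x) /\<^sub>R t) \<le> norm (T r x - x)"
      using norm_J_le[of t "T r x - x"] that by (simp add: field_simps)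
    then show ?thesis using eq[of t] that by simp
  qed
  then show "J r x \<in> gen_domain tau T"
    by (rule gen_domainI[OF _ lim])
qed

lemma fix_space_subset_ker_gen: "fix_space T \<subseteq> ker_gen tau T"
proof
  fix x assume x: "x \<in> fix_space T"
  have zero: "(T t x - x) /\<^sub>R t = 0" if "0 < t" for t
    using x that by (simp add: fix_space_def)
  have "\<forall>\<^sub>F t in at_right 0. (T t x - x) /\<^sub>R t = 0"
    unfolding eventually_at_right_field using zero by (intro exI[of _ 1]) simp
  then have lim: "limitin tau (\<lambda>t. (T t x - x) /\<^sub>R t) 0 (at_right 0)"
    by (intro limitin_eventually) simp
  have "norm ((T t x - x) /\<^sub>R t) \<le> 0" if "t \<in> {0<..<1}" for t
    using zero[of t] that by simp
  then have "x \<in> gen_domain tau T" by (rule gen_domainI[OF _ lim])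
  then show "x \<in> ker_gen tau T" using gen_eqI[OF lim] by (simp add: ker_gen_def)
qed

text \<open>The uniformity on bounded time intervals in bi-continuity makes the integrand small on
  all of [0, t] at once.\<close>

lemma J_limit_0:
  assumes "bounded (range z)" "limitin tau z 0 sequentially" "0 \<le> t"
  shows "limitin tau (\<lambda>n. J t (z n)) 0 sequentially"
  unfolding limitin_tau_iff
proof
  fix p assume p: "p \<in> P"
  show "(\<lambda>n. p (J t (z n) - 0)) \<longlonglongrightarrow> 0"
  proof (rule tendstoI)
    fix e :: real assume e: "e > 0"
    \<comment> \<open>The denominator t + 1 also covers t = 0 and makes \<open>d * t\<close>
      strictly smaller than \<open>e\<close>.\<close>
    define d where "d = e / (t + 1)"
    have d: "d > 0" "d * (t + 1) = e" using e assms(3) by (auto simp: d_def)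
    from T_limit_uniform[OF assms p d(1)]
    show "\<forall>\<^sub>F n in sequentially. dist (p (J t (z n) - 0)) 0 < e"
    proof eventually_elim
      case (elim n)
      have "p (J t (z n)) \<le> d * t"
      proof (rule J_seminorm_bound[OF assms(3) p])
        show "p (T s (z n)) \<le> d" if "s \<in> {0..t}" for s
          using elim that linear_0[OF T_linear, of s] by force
      qed
      also have "\<dots> < e" using d by (simp add: distrib_left)
      finally show ?case using p_nonneg[OF p] by (simp add: dist_real_def)
    qed
  qed
qed

text \<open>The difference quotients \<open>z n\<close> of \<open>x\<close> tend to 0 and are
  norm-bounded, so \<open>J t (z n)\<close> tends to 0. These vectors are also the difference
  quotients of \<open>J t x\<close>, whose limit is \<open>T t x - x\<close>.\<close>

lemma ker_gen_subset_fix_space: "ker_gen tau T \<subseteq> fix_space T"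
proof
  fix x assume x: "x \<in> ker_gen tau T"
  then have dom: "x \<in> gen_domain tau T" by (simp add: ker_gen_def)
  obtain y where y: "limitin tau (\<lambda>t. (T t x - x) /\<^sub>R t) y (at_right 0)"
    using dom by (auto simp: gen_domain_def)
  then have "y = 0" using gen_eqI[OF y] x by (simp add: ker_gen_def)
  with y have lim: "limitin tau (\<lambda>t. (T t x - x) /\<^sub>R t) 0 (at_right 0)" by simp
  \<comment> \<open>Starting at 1/2 keeps all times inside the open interval on which membership in
    the domain bounds the quotients.\<close>
  define h where "h n = inverse (real (Suc (Suc n)))" for n
  have h: "h n \<in> {0<..<1}" for n by (simp add: h_def inverse_less_1_iff)
  have "h \<longlonglongrightarrow> 0" unfolding h_def using LIMSEQ_Suc[OF LIMSEQ_inverse_real_of_nat] .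
  then have h0: "filterlim h (at_right 0) sequentially"
    using h by (intro tendsto_imp_filterlim_at_right) auto
  define z where "z n = (T (h n) x - x) /\<^sub>R h n" for n
  obtain B where "\<And>t. t \<in> {0<..<1} \<Longrightarrow> norm ((T t x - x) /\<^sub>R t) \<le> B"
    using dom unfolding gen_domain_def bdd_above_def by blast
  then have "bounded (range z)"
    using h unfolding bounded_iff z_def by blast
  moreover have "limitin tau z 0 sequentially"
    unfolding z_def by (rule limitin_compose_filterlim[OF lim h0])
  ultimately have z: "bounded (range z)" "limitin tau z 0 sequentially" by blast+
  have "T t x - x = 0" if t: "0 \<le> t" for t
  proof -
    have "J t (z n) = (T (h n) (J t x) - J t x) /\<^sub>R h n" for n
      using h[of n] t
      by (simp add: z_def linear_diff[OF J_linear] linear_scale[OF J_linear] T_J)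
    then have "limitin tau (\<lambda>n. (T (h n) (J t x) - J t x) /\<^sub>R h n) 0 sequentially"
      using J_limit_0[OF z t] by simp
    from limitin_tau_unique[OF limitin_compose_filterlim[OF J_gen(1)[OF t] h0] this]
    show ?thesis by simp
  qed
  then show "x \<in> fix_space T" by (simp add: fix_space_def)
qed

lemma fix_space_eq: "fix_space T = ker_gen tau T"
  using fix_space_subset_ker_gen ker_gen_subset_fix_space by (rule equalityI)

text \<open>A fixed functional annihilates all difference quotients. Conversely, every
  \<open>T t x - x\<close> is in the range of the generator, as the image of
  \<open>J t x\<close>.\<close>

lemma dual_fix_space_eq: "dual_fix_space scl tau T = ker_adjoint_gen scl tau T"
proof
  show "dual_fix_space scl tau T \<subseteq> ker_adjoint_gen scl tau T"
  proof
    fix \<phi> assume "\<phi> \<in> dual_fix_space scl tau T"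
    then have \<phi>: "\<phi> \<in> dual" "\<And>t x. 0 \<le> t \<Longrightarrow> \<phi> (T t x) = \<phi> x"
      by (auto simp: dual_fix_space_def fun_eq_iff)
    have "\<phi> (gen tau T x) = 0" if dom: "x \<in> gen_domain tau T" for x
    proof -
      obtain y where y: "limitin tau (\<lambda>t. (T t x - x) /\<^sub>R t) y (at_right 0)"
        using dom by (auto simp: gen_domain_def)
      have "((\<lambda>t. \<phi> ((T t x - x) /\<^sub>R t)) \<longlongrightarrow> 0) (at_right 0)"
      proof (rule tendsto_eventually)
        show "\<forall>\<^sub>F t in at_right 0. \<phi> ((T t x - x) /\<^sub>R t) = 0"
          unfolding eventually_at_right_field using \<phi>(2)
          by (intro exI[of _ 1]) (simp add: dual_scaleR[OF \<phi>(1)] dual_diff[OF \<phi>(1)])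
      qed
      then have "\<phi> y = 0"
        using tendsto_unique[OF _ dual_tendsto[OF \<phi>(1) y]] by simp
      then show ?thesis using gen_eqI[OF y] by simp
    qed
    then show "\<phi> \<in> ker_adjoint_gen scl tau T" using \<phi>(1) by (simp add: ker_adjoint_gen_def)
  qed
  show "ker_adjoint_gen scl tau T \<subseteq> dual_fix_space scl tau T"
  proof
    fix \<phi> assume "\<phi> \<in> ker_adjoint_gen scl tau T"
    then have \<phi>: "\<phi> \<in> dual" "\<And>x. x \<in> gen_domain tau T \<Longrightarrow> \<phi> (gen tau T x) = 0"
      by (auto simp: ker_adjoint_gen_def)
    have "\<phi> (T t x) = \<phi> x" if "0 \<le> t" for t x
      using \<phi>(2)[OF J_gen(2)[OF that, of x]] gen_eqI[OF J_gen(1)[OF that, of x]]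
      by (simp add: dual_diff[OF \<phi>(1)])
    then show "\<phi> \<in> dual_fix_space scl tau T" using \<phi>(1) by (auto simp: dual_fix_space_def)
  qed
qed

section \<open>Cesaro means and their weak limits\<close>

lemma norm_cesaro_le: "0 < r \<Longrightarrow> norm (cesaro tau T r x) \<le> norm x"
  using norm_J_le[of r x] by (simp add: cesaro_eq field_simps)

lemma cesaro_linear: "0 < r \<Longrightarrow> linear (cesaro tau T r)"
  using linear_compose_scale_right[OF J_linear, of r "1 / r"]
  by (simp add: cesaro_eq[abs_def])

lemma cesaro_scl: "0 < r \<Longrightarrow> cesaro tau T r (scl c x) = scl c (cesaro tau T r x)"
  by (simp add: cesaro_eq J_scl banach_scaling_scaleR[OF scl])

lemma T_cesaro: "0 \<le> t \<Longrightarrow> 0 < r \<Longrightarrow> T t (cesaro tau T r x) = cesaro tau T r (T t x)"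
  by (simp add: cesaro_eq linear_scale[OF T_linear] T_J)

lemma T_cesaro_diff:
  assumes t: "0 \<le> t" and r: "0 < r"
  shows "norm (T t (cesaro tau T r x) - cesaro tau T r x) \<le> 2 * t * norm x / r"
proof -
  have "T t (cesaro tau T r x) - cesaro tau T r x = (1 / r) *\<^sub>R (T t (J r x) - J r x)"
    using t by (simp add: cesaro_eq linear_scale[OF T_linear] scaleR_diff_right)
  also have "\<dots> = (1 / r) *\<^sub>R J t (T r x - x)"
    using T_J_diff[OF t, of r x] r by simp
  finally have "norm (T t (cesaro tau T r x) - cesaro tau T r x) = norm (J t (T r x - x)) / r"
    using r by simp
  also have "norm (J t (T r x - x)) \<le> norm (T r x - x) * t" by (rule norm_J_le[OF t])
  also have "\<dots> \<le> (norm x + norm x) * t"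
    using norm_triangle_ineq4[of "T r x" x] norm_T_le[of r x] r t by (intro mult_right_mono) auto
  finally show ?thesis using r by (simp add: divide_right_mono algebra_simps)
qed

text \<open>The filter is left general to cover both sequences of times and the full limit at
  infinity.\<close>

lemma T_cesaro_diff_tendsto:
  assumes t: "0 \<le> t" and r: "filterlim r at_top F"
  shows "((\<lambda>i. norm (T t (cesaro tau T (r i) x) - cesaro tau T (r i) x)) \<longlongrightarrow> 0) F"
proof (rule tendsto_sandwich[OF _ _ tendsto_const])
  show "((\<lambda>i. 2 * t * norm x / r i) \<longlongrightarrow> 0) F"
    by (intro tendsto_divide_0[OF tendsto_const] filterlim_at_top_imp_at_infinity r)
  have "\<forall>\<^sub>F i in F. 0 < r i" using r by (rule filterlim_at_top_dense[THEN iffD1, rule_format])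
  then show "\<forall>\<^sub>F i in F. norm (T t (cesaro tau T (r i) x) - cesaro tau T (r i) x) \<le> 2 * t * norm x / r i"
    by eventually_elim (rule T_cesaro_diff[OF t])
qed simp

text \<open>With \<open>closure_of_tau_inner\<close> this takes the place of approximating the means
  by convex combinations of orbit points.\<close>

lemma cesaro_inner_le:
  assumes \<phi>: "\<phi> \<in> dual" and r: "0 < r" and K: "\<And>s. 0 \<le> s \<Longrightarrow> inner (\<phi> (T s x)) 1 \<le> K"
  shows "inner (\<phi> (cesaro tau T r x)) 1 \<le> K"
proof -
  note int = dual_T_integrable[OF \<phi>, of 0 x r]
  have "inner (\<phi> (J r x)) 1 = integral {0..r} (\<lambda>s. inner (\<phi> (T s x)) 1)"
    using integral_linear[OF int bounded_linear_inner_left[of 1]] r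
    by (simp add: J_dual[OF _ \<phi>] o_def)
  also have "\<dots> \<le> integral {0..r} (\<lambda>s. K)"
    using integrable_linear[OF int bounded_linear_inner_left[of 1]] K
    by (intro integral_le) (auto simp: o_def)
  also have "\<dots> = r * K" using r by simp
  finally show ?thesis using r by (simp add: cesaro_eq dual_scaleR[OF \<phi>] field_simps)
qed

text \<open>The shared core of the two implications with conclusion (d). Convergence after applying
  \<open>T t\<close> is a separate hypothesis since weak convergence alone does not provide it: for
  tau-limits it comes from bi-continuity, for weak limits from the extra continuity
  condition.\<close>

lemma weak_limit_in_hull_fix:
  assumes r: "\<And>n. 0 < r n" "filterlim r at_top sequentially"
    and y: "\<And>\<phi>. \<phi> \<in> dual \<Longrightarrow> (\<lambda>n. \<phi> (cesaro tau T (r n) x)) \<longlonglongrightarrow> \<phi> y"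
    and Ty: "\<And>t \<phi>. 0 \<le> t \<Longrightarrow> \<phi> \<in> dual \<Longrightarrow>
      (\<lambda>n. \<phi> (T t (cesaro tau T (r n) x))) \<longlonglongrightarrow> \<phi> (T t y)"
  shows "y \<in> tau closure_of (convex hull ((\<lambda>t. T t x) ` {0..})) \<inter> fix_space T"
proof
  show "y \<in> tau closure_of (convex hull ((\<lambda>t. T t x) ` {0..}))"
  proof (rule closure_of_tau_inner)
    fix \<phi> K assume \<phi>: "\<phi> \<in> dual"
      and K: "\<And>c. c \<in> convex hull ((\<lambda>t. T t x) ` {0..}) \<Longrightarrow> inner (\<phi> c) 1 \<le> K"
    have "inner (\<phi> (cesaro tau T (r n) x)) 1 \<le> K" for n
      by (rule cesaro_inner_le[OF \<phi> r(1)]) (auto intro!: K hull_inc)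
    then show "inner (\<phi> y) 1 \<le> K"
      by (intro LIMSEQ_le_const2[OF tendsto_inner[OF y[OF \<phi>] tendsto_const]]) auto
  qed auto
  have "T t y = y" if t: "0 \<le> t" for t
  proof (rule dual_separates)
    fix \<phi> assume \<phi>: "\<phi> \<in> dual"
    have "(\<lambda>n. T t (cesaro tau T (r n) x) - cesaro tau T (r n) x) \<longlonglongrightarrow> 0"
      by (rule tendsto_norm_zero_cancel[OF T_cesaro_diff_tendsto[OF t r(2)]])
    then have "(\<lambda>n. \<phi> (T t (cesaro tau T (r n) x) - cesaro tau T (r n) x)) \<longlonglongrightarrow> \<phi> 0"
      by (rule bounded_linear.tendsto[OF dual_bounded_linear[OF \<phi>]])
    moreover have "(\<lambda>n. \<phi> (T t (cesaro tau T (r n) x) - cesaro tau T (r n) x)) \<longlonglongrightarrow> \<phi> (T t y) - \<phi> y"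
      unfolding dual_diff[OF \<phi>] by (intro tendsto_diff y Ty \<phi> t)
    ultimately show "\<phi> (T t y) = \<phi> y"
      using LIMSEQ_unique by (fastforce simp: dual_0[OF \<phi>])
  qed
  then show "y \<in> fix_space T" by (simp add: fix_space_def)
qed

lemma bounded_cesaro: "(\<And>n. 0 < r n) \<Longrightarrow> bounded (range (\<lambda>n. cesaro tau T (r n) x))"
  using norm_cesaro_le unfolding bounded_iff by blast

section \<open>The implications between the assertions\<close>

lemma filterlim_Suc_at_top: "filterlim (\<lambda>n. real (Suc n)) at_top sequentially"
  by (rule filterlim_compose[OF filterlim_real_sequentially filterlim_Suc])

text \<open>Convergence is immediate; the work is to see that the limits form a bounded operator.
  Linearity is inherited from the means through functionals, and the bound 1 from contractivity and
  norming.\<close>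

lemma mean_ergodic_imp_weakly:
  assumes "mean_ergodic tau T"
  shows "weakly_mean_ergodic scl tau T"
proof -
  obtain E where E: "\<And>x. limitin tau (\<lambda>r. cesaro tau T r x) (E x) at_top"
    using assms unfolding mean_ergodic_def by metis
  have \<phi>E: "((\<lambda>r. \<phi> (cesaro tau T r x)) \<longlongrightarrow> \<phi> (E x)) at_top" if "\<phi> \<in> dual" for \<phi> x
    by (rule dual_tendsto[OF that E])
  have pos: "\<forall>\<^sub>F r :: real in at_top. 0 < r" by (rule eventually_gt_at_top)
  have "E (x + y) = E x + E y" for x y
  proof (rule dual_separates)
    fix \<phi> assume \<phi>: "\<phi> \<in> dual"
    have "((\<lambda>r. \<phi> (cesaro tau T r (x + y))) \<longlongrightarrow> \<phi> (E x) + \<phi> (E y)) at_top"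
      by (rule Lim_transform_eventually[OF tendsto_add[OF \<phi>E[OF \<phi>] \<phi>E[OF \<phi>]]], use pos in eventually_elim)
        (simp add: linear_add[OF cesaro_linear] dual_add[OF \<phi>])
    from tendsto_unique[OF _ \<phi>E[OF \<phi>] this] show "\<phi> (E (x + y)) = \<phi> (E x + E y)"
      by (simp add: dual_add[OF \<phi>])
  qed
  moreover have "E (scl c x) = scl c (E x)" for c x
  proof (rule dual_separates)
    fix \<phi> assume \<phi>: "\<phi> \<in> dual"
    have "((\<lambda>r. \<phi> (cesaro tau T r (scl c x))) \<longlongrightarrow> c * \<phi> (E x)) at_top"
      by (rule Lim_transform_eventually[OF tendsto_mult_left[OF \<phi>E[OF \<phi>]]], use pos in eventually_elim)
        (simp add: cesaro_scl dual_scl[OF \<phi>])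
    from tendsto_unique[OF _ \<phi>E[OF \<phi>] this] show "\<phi> (E (scl c x)) = \<phi> (scl c (E x))"
      by (simp add: dual_scl[OF \<phi>])
  qed
  moreover have "norm (E x) \<le> 1 * norm x" for x
  proof (rule norm_le_if_dual)
    fix \<phi> assume \<phi>: "\<phi> \<in> dual" "onorm \<phi> \<le> 1"
    have "\<forall>\<^sub>F r in at_top. norm (\<phi> (cesaro tau T r x)) \<le> norm x"
      using pos by eventually_elim (rule order_trans[OF norm_dual_le[OF \<phi>] norm_cesaro_le])
    then show "norm (\<phi> (E x)) \<le> 1 * norm x"
      using tendsto_upperbound[OF tendsto_norm[OF \<phi>E[OF \<phi>(1)]]] by simp
  qed
  ultimately have "bounded_operator scl E"
    using scl unfolding bounded_operator_def Vector_Spaces.linear_iff banach_scaling_def by blast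
  then show ?thesis unfolding weakly_mean_ergodic_def using \<phi>E by blast
qed

lemma weakly_mean_ergodic_imp_accumulation:
  assumes "weakly_mean_ergodic scl tau T"
  shows "weak_accumulation scl tau T"
  unfolding weak_accumulation_def
proof
  fix x
  obtain E where E: "\<And>\<phi>. \<phi> \<in> dual \<Longrightarrow> ((\<lambda>r. \<phi> (cesaro tau T r x)) \<longlongrightarrow> \<phi> (E x)) at_top"
    using assms unfolding weakly_mean_ergodic_def by blast
  have "limitin (weak_topology scl tau) (\<lambda>n. cesaro tau T (real (Suc (id n))) x) (E x) sequentially"
    unfolding limitin_weak_topology_iff
    using filterlim_compose[OF E filterlim_Suc_at_top] by simp
  moreover have "strict_mono (id :: nat \<Rightarrow> nat)" by (simp add: strict_mono_def)
  ultimately show "\<exists>r. (\<forall>n. r n > 0) \<and> filterlim r at_top sequentially \<and>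
        (\<exists>y k. strict_mono (k :: nat \<Rightarrow> nat) \<and>
           limitin (weak_topology scl tau) (\<lambda>n. cesaro tau T (r (k n)) x) y sequentially)"
    using filterlim_Suc_at_top
    by (intro exI[of _ "\<lambda>n. real (Suc n)"] conjI exI[of _ "E x"] exI[of _ id]) auto
qed

lemma mean_ergodic_imp_hull:
  assumes "mean_ergodic tau T"
  shows "hull_meets_fix tau T"
  unfolding hull_meets_fix_def
proof
  fix x
  obtain y where "limitin tau (\<lambda>r. cesaro tau T r x) y at_top"
    using assms unfolding mean_ergodic_def by blast
  then have y: "limitin tau (\<lambda>n. cesaro tau T (real (Suc n)) x) y sequentially"
    by (rule limitin_compose_filterlim[OF _ filterlim_Suc_at_top])
  have "y \<in> tau closure_of (convex hull ((\<lambda>t. T t x) ` {0..})) \<inter> fix_space T"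
  proof (rule weak_limit_in_hull_fix[OF _ filterlim_Suc_at_top])
    show "(\<lambda>n. \<phi> (cesaro tau T (real (Suc n)) x)) \<longlonglongrightarrow> \<phi> y" if "\<phi> \<in> dual" for \<phi>
      by (rule dual_tendsto[OF that y])
    show "(\<lambda>n. \<phi> (T t (cesaro tau T (real (Suc n)) x))) \<longlonglongrightarrow> \<phi> (T t y)"
      if "0 \<le> t" "\<phi> \<in> dual" for t \<phi>
      by (rule dual_tendsto[OF that(2) T_limit[OF bounded_cesaro y that(1)]]) simp
  qed simp
  then show "tau closure_of (convex hull ((\<lambda>t. T t x) ` {0..})) \<inter> fix_space T \<noteq> {}" by blast
qed

lemma weak_accumulation_imp_hull:
  assumes "weakly_seq_continuous scl tau T" "weak_accumulation scl tau T"
  shows "hull_meets_fix tau T"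
  unfolding hull_meets_fix_def
proof
  fix x
  obtain r y k where r: "\<And>n::nat. (r n :: real) > 0" "filterlim r at_top sequentially"
    and k: "strict_mono (k :: nat \<Rightarrow> nat)"
    and y: "limitin (weak_topology scl tau) (\<lambda>n. cesaro tau T (r (k n)) x) y sequentially"
    using assms(2) unfolding weak_accumulation_def by metis
  have Ty: "limitin (weak_topology scl tau) (\<lambda>n. T t (cesaro tau T (r (k n)) x)) (T t y) sequentially"
    if "0 \<le> t" for t
    using assms(1) bounded_cesaro[of "\<lambda>n. r (k n)" x] r(1) y that
    unfolding weakly_seq_continuous_def by blast
  have "y \<in> tau closure_of (convex hull ((\<lambda>t. T t x) ` {0..})) \<inter> fix_space T"
  proof (rule weak_limit_in_hull_fix)
    show "filterlim (\<lambda>n. r (k n)) at_top sequentially"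
      by (rule filterlim_compose[OF r(2) filterlim_subseq[OF k]])
  qed (use r(1) y Ty in \<open>auto simp: limitin_weak_topology_iff\<close>)
  then show "tau closure_of (convex hull ((\<lambda>t. T t x) ` {0..})) \<inter> fix_space T \<noteq> {}" by blast
qed

text \<open>A fixed functional is constant on an orbit, hence on its closed convex hull. The fixed
  point found there distinguishes two such functionals as well as the initial vector does.\<close>

lemma hull_imp_fix_separates:
  assumes "hull_meets_fix tau T"
  shows "fix_separates scl tau T"
  unfolding fix_separates_def
proof (intro ballI impI)
  fix \<phi> \<psi> assume \<phi>: "\<phi> \<in> dual_fix_space scl tau T" and \<psi>: "\<psi> \<in> dual_fix_space scl tau T"
    and ne: "\<phi> \<noteq> \<psi>"
  obtain x where x: "\<phi> x \<noteq> \<psi> x" using ne by blast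
  obtain y where y: "y \<in> tau closure_of (convex hull ((\<lambda>t. T t x) ` {0..}))" "y \<in> fix_space T"
    using assms unfolding hull_meets_fix_def by blast
  have const: "\<theta> y = \<theta> x" if "\<theta> \<in> dual_fix_space scl tau T" for \<theta>
  proof -
    have \<theta>: "\<theta> \<in> dual" "\<And>t x. 0 \<le> t \<Longrightarrow> \<theta> (T t x) = \<theta> x"
      using that by (auto simp: dual_fix_space_def fun_eq_iff)
    have "convex {z. \<theta> z = \<theta> x}"
      unfolding convex_def
      by (auto simp: dual_add[OF \<theta>(1)] dual_scaleR[OF \<theta>(1)] simp flip: scaleR_add_left)
    then have "convex hull ((\<lambda>t. T t x) ` {0..}) \<subseteq> {z. \<theta> z = \<theta> x}"
      by (intro hull_minimal) (auto simp: \<theta>(2))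
    moreover have "closedin tau {z. \<theta> z = \<theta> x}"
      using closedin_continuous_map_preimage[OF dual_continuous[OF \<theta>(1)], of "{\<theta> x}"] by simp
    ultimately show ?thesis using closure_of_minimal y(1) by blast
  qed
  show "\<exists>x\<in>fix_space T. \<phi> x \<noteq> \<psi> x"
    using y(2) x const[OF \<phi>] const[OF \<psi>] by metis
qed

text \<open>Equicontinuity makes the space of vectors with convergent means \<open>\<tau>\<close>-closed: the means of
  a limit point form a bounded Cauchy net.\<close>

lemma convergent_means_closed:
  assumes equi: "equicontinuous_semigroup P T"
    and x: "\<And>p e. p \<in> P \<Longrightarrow> e > 0 \<Longrightarrow>
      \<exists>z l. limitin tau (\<lambda>r. cesaro tau T r z) l at_top \<and> p (x - z) < e"
  shows "\<exists>l. limitin tau (\<lambda>r. cesaro tau T r x) l at_top"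
proof -
  have Cauchy: "\<exists>R>0. \<forall>r\<ge>R. \<forall>s\<ge>R. p (cesaro tau T r x - cesaro tau T s x) < e"
    if p: "p \<in> P" and e: "e > 0" for p e
  proof -
    obtain c q where q: "c \<ge> 1" "q \<in> P" "\<And>x t. 0 \<le> t \<Longrightarrow> p (T t x) \<le> c * q x"
      using equi p unfolding equicontinuous_semigroup_def by blast
    \<comment> \<open>Equicontinuity passes to the means with the same constant, since the bound on
      the orbit is uniform in time.\<close>
    have C: "p (cesaro tau T r z) \<le> c * q z" if "0 < r" for r z
    proof -
      have "p (J r z) \<le> c * q z * r"
        using that q(3) by (intro J_seminorm_bound[OF _ p]) auto
      then show ?thesis using that by (simp add: cesaro_eq p_scaleR[OF p] field_simps)
    qed
    \<comment> \<open>The factor c is absorbed here; approximation and convergence then cost e/4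
      each, so any two late means differ by less than e.\<close>
    have "e / (4 * c) > 0" using e q(1) by simp
    then obtain z l where z: "limitin tau (\<lambda>r. cesaro tau T r z) l at_top" "q (x - z) < e / (4 * c)"
      using x[OF q(2)] by blast
    then have cz: "c * q (x - z) < e / 4" using q(1) by (simp add: field_simps)
    have "((\<lambda>r. p (cesaro tau T r z - l)) \<longlongrightarrow> 0) at_top"
      using z(1) p by (simp add: limitin_tau_iff)
    then have "\<forall>\<^sub>F r in at_top. p (cesaro tau T r z - l) < e / 4"
      by (rule order_tendstoD) (use e in simp)
    then obtain R where R: "\<And>r. r \<ge> R \<Longrightarrow> p (cesaro tau T r z - l) < e / 4"
      unfolding eventually_at_top_linorder by blast
    \<comment> \<open>The maximum with 1 keeps \<open>r\<close> positive, where the mean is a linear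
      operator.\<close>
    have near: "p (cesaro tau T r x - l) < e / 2" if "r \<ge> max R 1" for r
    proof -
      have "p (cesaro tau T r (x - z)) < e / 4" using C[of r "x - z"] cz that by simp
      moreover have "cesaro tau T r x - l = cesaro tau T r (x - z) + (cesaro tau T r z - l)"
        using that by (simp add: linear_diff[OF cesaro_linear])
      then have "p (cesaro tau T r x - l) \<le> p (cesaro tau T r (x - z)) + p (cesaro tau T r z - l)"
        using p_add[OF p] by metis
      ultimately show ?thesis using R[of r] that by simp
    qed
    have "p (cesaro tau T r x - cesaro tau T s x) < e" if "r \<ge> max R 1" "s \<ge> max R 1" for r s
      using near[OF that(1)] near[OF that(2)] p_minus_commute[OF p, of l]
        p_add[OF p, of "cesaro tau T r x - l" "l - cesaro tau T s x"] by simp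
    then show ?thesis by (intro exI[of _ "max R 1"]) auto
  qed
  \<comment> \<open>Completeness is sequential, so the limit is found along integer times; the
    Cauchy estimate then carries it over to all large \<open>r\<close>.\<close>
  define S where "S n = cesaro tau T (real (Suc n)) x" for n
  have "Cauchy_in tau S"
  proof (rule Cauchy_in_tauI)
    fix p e assume pe: "p \<in> P" "(e::real) > 0"
    from Cauchy[OF pe] obtain R
      where R: "\<And>r s. r \<ge> R \<Longrightarrow> s \<ge> R \<Longrightarrow> p (cesaro tau T r x - cesaro tau T s x) < e" by blast
    obtain N where "real N \<ge> R" using real_arch_simple by blast
    then show "\<exists>N. \<forall>m\<ge>N. \<forall>n\<ge>N. p (S m - S n) < e"
      unfolding S_def by (intro exI[of _ N] allI impI R) auto
  qed
  moreover have "bounded (range S)" unfolding S_def by (rule bounded_cesaro) simp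
  ultimately obtain l where l: "limitin tau S l sequentially"
    using bounded_Cauchy_limit by blast
  have "limitin tau (\<lambda>r. cesaro tau T r x) l at_top"
    unfolding limitin_tau_iff
  proof
    fix p assume p: "p \<in> P"
    show "((\<lambda>r. p (cesaro tau T r x - l)) \<longlongrightarrow> 0) at_top"
    proof (rule tendstoI)
      fix e :: real assume e: "e > 0"
      from Cauchy[OF p, of "e / 2"] e obtain R
        where R: "\<And>r s. r \<ge> R \<Longrightarrow> s \<ge> R \<Longrightarrow> p (cesaro tau T r x - cesaro tau T s x) < e / 2"
        by auto
      have "(\<lambda>n. p (S n - l)) \<longlonglongrightarrow> 0" using l p by (simp add: limitin_tau_iff)
      then have "\<forall>\<^sub>F n in sequentially. p (S n - l) < e / 2"
        by (rule order_tendstoD) (use e in simp)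
      moreover have "\<forall>\<^sub>F n in sequentially. R \<le> real (Suc n)"
        using filterlim_Suc_at_top by (simp add: filterlim_at_top)
      ultimately obtain n where n: "p (S n - l) < e / 2" "R \<le> real (Suc n)"
        using eventually_happens[OF eventually_conj] by fastforce
      have "p (cesaro tau T r x - l) < e" if "r \<ge> R" for r
        using p_add[OF p, of "cesaro tau T r x - S n" "S n - l"] R[OF that n(2)] n(1)
        by (simp add: S_def)
      then show "\<forall>\<^sub>F r in at_top. dist (p (cesaro tau T r x - l)) 0 < e"
        unfolding eventually_at_top_linorder using p_nonneg[OF p]
        by (intro exI[of _ R]) (simp add: dist_real_def)
    qed
  qed
  then show ?thesis ..
qed

lemma fix_separates_imp_mean_ergodic:
  assumes equi: "equicontinuous_semigroup P T" and sep: "fix_separates scl tau T"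
  shows "mean_ergodic tau T"
proof (rule ccontr)
  define L where "L = {x. \<exists>l. limitin tau (\<lambda>r. cesaro tau T r x) l at_top}"
  assume "\<not> mean_ergodic tau T"
  then obtain x where x: "x \<notin> L" by (auto simp: mean_ergodic_def L_def)
  have pos: "\<forall>\<^sub>F r :: real in at_top. 0 < r" by (rule eventually_gt_at_top)
  \<comment> \<open>The contrapositive of closedness: a single seminorm keeps \<open>x\<close> at a
    positive distance from \<open>L\<close>.\<close>
  obtain p e where p: "p \<in> P" and e: "e > 0" "\<And>z. z \<in> L \<Longrightarrow> e \<le> p (x - z)"
    using convergent_means_closed[OF equi, of x] x unfolding L_def by (auto simp: not_less) (metis not_le)
  have add: "y + z \<in> L" if yz: "y \<in> L" "z \<in> L" for y z
  proof -
    obtain l m where lm: "limitin tau (\<lambda>r. cesaro tau T r y) l at_top"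
      "limitin tau (\<lambda>r. cesaro tau T r z) m at_top" using yz by (auto simp: L_def)
    have "limitin tau (\<lambda>r. cesaro tau T r (y + z)) (l + m) at_top"
      unfolding limitin_tau_iff
    proof
      fix p assume p: "p \<in> P"
      have lim: "((\<lambda>r. p (cesaro tau T r y - l) + p (cesaro tau T r z - m)) \<longlongrightarrow> 0 + 0) at_top"
        using lm p by (intro tendsto_add) (auto simp: limitin_tau_iff)
      have le: "\<forall>\<^sub>F r in at_top. p (cesaro tau T r (y + z) - (l + m))
          \<le> p (cesaro tau T r y - l) + p (cesaro tau T r z - m)"
        using pos
      proof eventually_elim
        case (elim r)
        have "cesaro tau T r (y + z) - (l + m) = (cesaro tau T r y - l) + (cesaro tau T r z - m)"
          by (simp add: linear_add[OF cesaro_linear[OF elim]])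
        then show ?case using p_add[OF p] by metis
      qed
      show "((\<lambda>r. p (cesaro tau T r (y + z) - (l + m))) \<longlongrightarrow> 0) at_top"
        by (rule tendsto_sandwich[OF _ le tendsto_const]) (use lim p_nonneg[OF p] in simp_all)
    qed
    then show ?thesis by (auto simp: L_def)
  qed
  have scale: "scl c y \<in> L" if y: "y \<in> L" for c y
  proof -
    obtain l where l: "limitin tau (\<lambda>r. cesaro tau T r y) l at_top"
      using y by (auto simp: L_def)
    have "limitin tau (\<lambda>r. cesaro tau T r (scl c y)) (scl c l) at_top"
      unfolding limitin_tau_iff
    proof
      fix p assume p: "p \<in> P"
      have "((\<lambda>r. norm c * p (cesaro tau T r y - l)) \<longlongrightarrow> norm c * 0) at_top"
        using l p by (intro tendsto_mult_left) (auto simp: limitin_tau_iff)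
      then have "((\<lambda>r. p (scl c (cesaro tau T r y - l))) \<longlongrightarrow> 0) at_top"
        by (simp add: p_scale[OF p])
      moreover have "\<forall>\<^sub>F r in at_top. p (scl c (cesaro tau T r y - l)) = p (cesaro tau T r (scl c y) - scl c l)"
        using pos
      proof eventually_elim
        case (elim r)
        have "scl c (cesaro tau T r y) = scl c (cesaro tau T r y - l) + scl c l"
          using banach_scaling_add_right[OF scl, of c "cesaro tau T r y - l" l] by simp
        then show ?case by (simp add: cesaro_scl[OF elim])
      qed
      ultimately show "((\<lambda>r. p (cesaro tau T r (scl c y) - scl c l)) \<longlongrightarrow> 0) at_top"
        by (rule Lim_transform_eventually)
    qed
    then show ?thesis by (auto simp: L_def)
  qed
  have diff: "T t y - y \<in> L" if t: "0 \<le> t" for t y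
  proof -
    have "limitin tau (\<lambda>r. cesaro tau T r (T t y - y)) 0 at_top"
      unfolding limitin_tau_iff
    proof
      fix p assume p: "p \<in> P"
      show "((\<lambda>r. p (cesaro tau T r (T t y - y) - 0)) \<longlongrightarrow> 0) at_top"
      proof (rule tendsto_sandwich[OF _ _ tendsto_const])
        show "((\<lambda>r. norm (T t (cesaro tau T r y) - cesaro tau T r y)) \<longlongrightarrow> 0) at_top"
          by (rule T_cesaro_diff_tendsto[OF t filterlim_ident])
        \<comment> \<open>The means of \<open>T t y - y\<close> vanish even in norm, and the norm
          dominates each seminorm of \<open>P\<close>.\<close>
        show "\<forall>\<^sub>F r in at_top. p (cesaro tau T r (T t y - y) - 0)
            \<le> norm (T t (cesaro tau T r y) - cesaro tau T r y)"
          using pos by eventually_elim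
            (simp add: linear_diff[OF cesaro_linear] T_cesaro[OF t] seminorm_le_norm[OF p])
      qed (use p_nonneg[OF p] in simp)
    qed
    then show ?thesis by (auto simp: L_def)
  qed
  have fixed: "y \<in> L" if y: "y \<in> fix_space T" for y
  proof -
    have "cesaro tau T r y = y" if r: "0 < r" for r
    proof (rule dual_separates)
      fix \<phi> assume \<phi>: "\<phi> \<in> dual"
      have "integral {0..r} (\<lambda>s. \<phi> (T s y)) = integral {0..r} (\<lambda>s. \<phi> y)"
        by (rule integral_cong) (use y in \<open>simp add: fix_space_def\<close>)
      then show "\<phi> (cesaro tau T r y) = \<phi> y"
        using r by (simp add: cesaro_eq dual_scaleR[OF \<phi>] J_dual[OF _ \<phi>])
    qed
    then have "\<forall>\<^sub>F r in at_top. cesaro tau T r y = y"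
      using pos by (rule eventually_mono[rotated])
    then have "limitin tau (\<lambda>r. cesaro tau T r y) y at_top" by (intro limitin_eventually) simp
    then show ?thesis by (auto simp: L_def)
  qed
  have "0 \<in> L" using diff[of 0 0] by simp
  then obtain \<phi> where \<phi>: "\<phi> \<in> dual" "\<And>z. z \<in> L \<Longrightarrow> \<phi> z = 0" "\<phi> x \<noteq> 0"
    using dual_vanishing[OF scale add _ p e] by blast
  have "\<phi> (T t y) = \<phi> y" if "0 \<le> t" for t y
    using \<phi>(2)[OF diff[OF that]] by (simp add: dual_diff[OF \<phi>(1)])
  then have "\<phi> \<in> dual_fix_space scl tau T" using \<phi>(1) by (auto simp: dual_fix_space_def)
  \<comment> \<open>Separation speaks of pairs of functionals, so \<open>\<phi>\<close> is compared
    with the zero functional.\<close>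
  moreover have "(\<lambda>x. 0) \<in> dual_fix_space scl tau T"
    using zero_in_dual by (auto simp: dual_fix_space_def)
  moreover have "\<phi> \<noteq> (\<lambda>x. 0)" using \<phi>(3) by auto
  ultimately obtain z where "z \<in> fix_space T" "\<phi> z \<noteq> 0"
    using sep unfolding fix_separates_def by blast
  then show False using fixed \<phi>(2) by blast
qed

end

theorem theorem3p10:
  fixes scl :: "'k::{real_normed_field,euclidean_space} \<Rightarrow> 'a::banach \<Rightarrow> 'a"
    and tau :: "'a topology"
    and P :: "('a \<Rightarrow> real) set"
    and T :: "real \<Rightarrow> 'a \<Rightarrow> 'a"
  assumes "bicontinuous_setting scl tau P"
    and "bicontinuous_semigroup scl tau T"
    and "contraction_semigroup T"
  shows "fix_space T = ker_gen tau T
    \<and> dual_fix_space scl tau T = ker_adjoint_gen scl tau T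
    \<and> (mean_ergodic tau T \<longrightarrow> weakly_mean_ergodic scl tau T)
    \<and> (weakly_mean_ergodic scl tau T \<longrightarrow> weak_accumulation scl tau T)
    \<and> (mean_ergodic tau T \<longrightarrow> hull_meets_fix tau T)
    \<and> (hull_meets_fix tau T \<longrightarrow> fix_separates scl tau T)
    \<and> (weakly_seq_continuous scl tau T \<longrightarrow>
         weak_accumulation scl tau T \<longrightarrow> hull_meets_fix tau T)
    \<and> (equicontinuous_semigroup P T \<longrightarrow>
         fix_separates scl tau T \<longrightarrow> mean_ergodic tau T)"
proof -
  interpret contraction_bicontinuous scl tau P T
    by unfold_locales (fact assms)+
  show ?thesis
    using fix_space_eq dual_fix_space_eq
      mean_ergodic_imp_weakly weakly_mean_ergodic_imp_accumulation mean_ergodic_imp_hull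
      hull_imp_fix_separates weak_accumulation_imp_hull fix_separates_imp_mean_ergodic
    by (intro conjI impI)
qed

end
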